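(* Let $r,k,s$ be positive integers, let $A=\mathbb{D}^r_k$ be the algebra of $r$-jets at $0$ of smooth functions $\mathbb{R}^k\to\mathbb{R}$, and let $(\mathbb{D}^r_k)_s=A_s$ be the real vector space of skew-symmetric $s$-linear maps $F:A\times\dots\times A\to A^*$ satisfying the derivation-type identity given in the context. Then the dimension of the vector space $(\mathbb{D}^r_k)_s$ equals $$\binom{r+s-1}{s}\binom{r+k}{r+s}.$$
   Context: $\mathbb{D}^r_k$ is the commutative unital $\mathbb{R}$-algebra of $r$-jets at $0$ of smooth functions $\mathbb{R}^k\to\mathbb{R}$. For $i\in\{1,\dots,k\}$, $x^i\in\mathbb{D}^r_k$ (with $i$ an upper index, not a power) is the $r$-jet at $0$ of the coordinate function $u\mapsto u^i$. For $\alpha\in\mathbb{N}^k$ (where $\mathbb{N}$ is the set of non-negative integers), put $|\alpha|=\alpha^1+\dots+\alpha^k$ and $x^\alpha=(x^1)^{\alpha^1}\cdots(x^k)^{\alpha^k}$. The elements $x^\varepsilon$ with $|\varepsilon|\le r$ form a basis of $\mathbb{D}^r_k$ over $\mathbb{R}$, and $x^\zeta x^\eta=x^{\zeta+\eta}$ if $|\zeta+\eta|\le r$ and $x^\zeta x^\eta=0$ otherwise. (Equivalently, $\mathbb{D}^r_k\cong\mathbb{R}[x^1,\dots,x^k]/(x^1,\dots,x^k)^{r+1}$.) For a finite-dimensional commutative unital $\mathbb{R}$-algebra $A$, $A^*$ denotes the vector space of $\mathbb{R}$-linear functions $A\to\mathbb{R}$. For a positive integer $s$, $A_s$ is the real vector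 space of skew-symmetric $s$-linear (over $\mathbb{R}$) maps $F:A\times\dots\times A\to A^*$ satisfying $$F(a_1,\dots,a_{t-1},bc,a_{t+1},\dots,a_s)(d)=F(a_1,\dots,a_{t-1},b,a_{t+1},\dots,a_s)(cd)+F(a_1,\dots,a_{t-1},c,a_{t+1},\dots,a_s)(bd)$$ for every $t\in\{1,\dots,s\}$ and all $a_1,\dots,a_{t-1},a_{t+1},\dots,a_s,b,c,d\in A$. Convention: for non-negative integers $a,b$, the binomial coefficient $\binom{a}{b}$ is $0$ when $b>a$. *)

theory Defs
  imports "HOL-Analysis.Analysis" "HOL-Algebra.Module" "HOL-Library.Function_Algebras"
begin

definition partial_deriv :: "'k::finite \<Rightarrow> (real ^ 'k \<Rightarrow> real) \<Rightarrow> real ^ 'k \<Rightarrow> real"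
  where "partial_deriv i f = (\<lambda>u. frechet_derivative f (at u) (axis i 1))"

definition partial_derivs :: "'k::finite list \<Rightarrow> (real ^ 'k \<Rightarrow> real) \<Rightarrow> real ^ 'k \<Rightarrow> real"
  where "partial_derivs is f = foldr partial_deriv is f"

text \<open>If all iterated partial derivatives are differentiable, they are all continuous, so this
  is the usual notion of a \<open>C\<^sup>\<infinity>\<close> function.\<close>

definition smooth :: "(real ^ 'k::finite \<Rightarrow> real) \<Rightarrow> bool"
  where "smooth f \<longleftrightarrow> (\<forall>is u. partial_derivs is f differentiable (at u))"

definition jet_rel :: "nat \<Rightarrow> ((real ^ 'k::finite \<Rightarrow> real) \<times> (real ^ 'k \<Rightarrow> real)) set"
  where "jet_rel r = {(f, g). smooth f \<and> smooth g \<and>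
    (\<forall>is. length is \<le> r \<longrightarrow> partial_derivs is f 0 = partial_derivs is g 0)}"

type_synonym 'k jet = "(real ^ 'k \<Rightarrow> real) set"

lemma equiv_jet_rel: "equiv {f. smooth f} (jet_rel r)"
  by (rule equivI) (auto simp: jet_rel_def refl_on_def sym_def trans_def)

text \<open>The operations are those induced on equivalence classes by the pointwise operations on
  representatives (the unions are over sets that are all equal).\<close>

definition jet_algebra :: "nat \<Rightarrow> (real, 'k::finite jet) module"
  where "jet_algebra r =
    \<lparr> carrier = {f. smooth f} // jet_rel r,
      mult = (\<lambda>X Y. \<Union>f\<in>X. \<Union>g\<in>Y. jet_rel r `` {\<lambda>u. f u * g u}),
      one = jet_rel r `` {\<lambda>u. 1},
      zero = jet_rel r `` {\<lambda>u. 0},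
      add = (\<lambda>X Y. \<Union>f\<in>X. \<Union>g\<in>Y. jet_rel r `` {\<lambda>u. f u + g u}),
      smult = (\<lambda>c X. \<Union>f\<in>X. jet_rel r `` {\<lambda>u. c * f u}) \<rparr>"

text \<open>A map with a restricted domain is represented by the total function that is \<open>0\<close> outside
  that domain, so that the maps in question form a vector space under pointwise operations.\<close>

definition dual :: "(real, 'a) module \<Rightarrow> ('a \<Rightarrow> real) set"
  where "dual A = {\<phi>.
    (\<forall>x. x \<notin> carrier A \<longrightarrow> \<phi> x = 0) \<and>
    (\<forall>x\<in>carrier A. \<forall>y\<in>carrier A. \<phi> (x \<oplus>\<^bsub>A\<^esub> y) = \<phi> x + \<phi> y) \<and>
    (\<forall>c. \<forall>x\<in>carrier A. \<phi> (c \<odot>\<^bsub>A\<^esub> x) = c * \<phi> x)}"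

text \<open>The elements of \<open>A \<times> \<dots> \<times> A\<close> are lists of length \<open>s\<close>, so argument positions run over \<open>0, \<dots>, s - 1\<close>.\<close>

definition tuples :: "(real, 'a) module \<Rightarrow> nat \<Rightarrow> 'a list set"
  where "tuples A s = {a. length a = s \<and> set a \<subseteq> carrier A}"

definition multilinear :: "(real, 'a) module \<Rightarrow> nat \<Rightarrow> ('a list \<Rightarrow> 'a \<Rightarrow> real) \<Rightarrow> bool"
  where "multilinear A s F \<longleftrightarrow> (\<forall>a\<in>tuples A s. \<forall>t<s.
    (\<forall>b\<in>carrier A. \<forall>c\<in>carrier A. F (a[t := b \<oplus>\<^bsub>A\<^esub> c]) = F (a[t := b]) + F (a[t := c])) \<and>
    (\<forall>c. \<forall>b\<in>carrier A. F (a[t := c \<odot>\<^bsub>A\<^esub> b]) = (\<lambda>d. c * F (a[t := b]) d)))"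

definition skew_symmetric :: "(real, 'a) module \<Rightarrow> nat \<Rightarrow> ('a list \<Rightarrow> 'a \<Rightarrow> real) \<Rightarrow> bool"
  where "skew_symmetric A s F \<longleftrightarrow> (\<forall>a\<in>tuples A s. \<forall>i<s. \<forall>j<s.
    i \<noteq> j \<longrightarrow> F (a[i := a ! j, j := a ! i]) = - F a)"

definition derivation_identity :: "(real, 'a) module \<Rightarrow> nat \<Rightarrow> ('a list \<Rightarrow> 'a \<Rightarrow> real) \<Rightarrow> bool"
  where "derivation_identity A s F \<longleftrightarrow> (\<forall>a\<in>tuples A s. \<forall>t<s.
    \<forall>b\<in>carrier A. \<forall>c\<in>carrier A. \<forall>d\<in>carrier A.
      F (a[t := b \<otimes>\<^bsub>A\<^esub> c]) d = F (a[t := b]) (c \<otimes>\<^bsub>A\<^esub> d) + F (a[t := c]) (b \<otimes>\<^bsub>A\<^esub> d))"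

definition skew_derivations :: "(real, 'a) module \<Rightarrow> nat \<Rightarrow> ('a list \<Rightarrow> 'a \<Rightarrow> real) set"
  where "skew_derivations A s = {F.
    (\<forall>a. a \<notin> tuples A s \<longrightarrow> F a = 0) \<and> (\<forall>a\<in>tuples A s. F a \<in> dual A) \<and>
    multilinear A s F \<and> skew_symmetric A s F \<and> derivation_identity A s F}"

definition map_scale :: "real \<Rightarrow> ('a list \<Rightarrow> 'a \<Rightarrow> real) \<Rightarrow> 'a list \<Rightarrow> 'a \<Rightarrow> real"
  where "map_scale c F = (\<lambda>a d. c * F a d)"

lemma vector_space_map_scale: "vector_space map_scale"
  by unfold_locales (auto simp: map_scale_def fun_eq_iff algebra_simps)

lemma subspace_skew_derivations: "module.subspace map_scale (skew_derivations A s)"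
proof -
  interpret vector_space "map_scale :: real \<Rightarrow> ('a list \<Rightarrow> 'a \<Rightarrow> real) \<Rightarrow> _"
    by (rule vector_space_map_scale)
  show ?thesis
    unfolding subspace_def skew_derivations_def dual_def multilinear_def skew_symmetric_def
      derivation_identity_def map_scale_def
    by (auto simp: fun_eq_iff algebra_simps)
qed

end

(*
An element F of A_s is determined by the numbers F(x^{i_1}, ..., x^{i_s})(x^M), where M is a
multi-index with |M| <= r. The only relations between them, besides skew-symmetry, come from
x^beta = 0 for |beta| = r + 1: by the Leibniz rule they say that the part with |M| = r is a cocycle
of the Koszul complex. For an ordering of the coordinates, such a relation with beta = M + max I
expresses the number at (I, M), where max I >= max M, through numbers at (I', M') with
max I' < max M'; so the pairs (I, M) with |M| < r, or |M| = r and max I < max M, determine F.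
Conversely, every such pair is realised: for |M| < r by a coordinate form, and for |M| = r by the
contraction of a monomial form with the Euler vector field, which is a cocycle because contracting
twice gives 0. Counting these pairs gives the dimension.
*)

theory Submission
  imports Defs "HOL-Combinatorics.Permutations"
begin

section \<open>Iterated partial derivatives and Taylor jets\<close>

text \<open>The cocycle condition has an analytic source. A form is written as F(f_1, ..., f_s)(g) =
  sum over I and M of C(I, M) times the M-th derivative at 0 of g d_{I_1} f_1 ... d_{I_s} f_s. For
  arbitrary skew coefficients this is skew-symmetric and multilinear, satisfies the derivation
  identity and sees only the r-jet of g. The obstacle is that each slot is differentiated up to r +
  1 times, although it may only matter through its r-jet. If b has zero r-jet, only the terms with
  |M| = r survive in its slot, each as a multiple of the derivative of b of index M + i; grouping
  them by beta = M + i leaves exactly the cocycle sums. The forms so obtained are an exact dual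
  basis to the values at the chosen pairs, so no triangular system has to be solved and a single
  lemma on dual bases yields the dimension. In the count, with q = r - 1, the pairs with |M| < r
  contribute C(q+s, s) C(q+k, q+s) and those with |M| = r contribute C(q+s, s) C(q+k, q+s+1);
  Pascal's rule adds them up.\<close>

lemma partial_deriv_eq:
  assumes "(f has_derivative f') (at u)"
  shows "partial_deriv i f u = f' (axis i 1)"
  using frechet_derivative_at[OF assms] by (simp add: partial_deriv_def)

lemma partial_deriv_add:
  assumes "\<And>u. f differentiable at u" "\<And>u. g differentiable at u"
  shows "partial_deriv i (\<lambda>u. f u + g u) = (\<lambda>u. partial_deriv i f u + partial_deriv i g u)"
proof
  fix u
  have "((\<lambda>u. f u + g u) has_derivative
      (\<lambda>v. frechet_derivative f (at u) v + frechet_derivative g (at u) v)) (at u)"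
    using assms by (intro has_derivative_add) (simp_all flip: frechet_derivative_works)
  from partial_deriv_eq[OF this]
  show "partial_deriv i (\<lambda>u. f u + g u) u = partial_deriv i f u + partial_deriv i g u"
    by (simp add: partial_deriv_def)
qed

lemma partial_deriv_mult:
  assumes "\<And>u. f differentiable at u" "\<And>u. g differentiable at u"
  shows "partial_deriv i (\<lambda>u. f u * g u) = (\<lambda>u. f u * partial_deriv i g u + g u * partial_deriv i f u)"
proof
  fix u
  have "((\<lambda>u. f u * g u) has_derivative
      (\<lambda>v. f u * frechet_derivative g (at u) v + frechet_derivative f (at u) v * g u)) (at u)"
    using assms by (intro has_derivative_mult) (simp_all flip: frechet_derivative_works)
  from partial_deriv_eq[OF this]
  show "partial_deriv i (\<lambda>u. f u * g u) u = f u * partial_deriv i g u + g u * partial_deriv i f u"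
    by (simp add: partial_deriv_def)
qed

lemma partial_deriv_const [simp]: "partial_deriv i (\<lambda>u. c) = (\<lambda>u. 0)"
  by (simp add: partial_deriv_def)

lemma partial_deriv_coord [simp]: "partial_deriv i (\<lambda>u. u $ j) = (\<lambda>u. if i = j then 1 else 0)"
proof
  fix u :: "real ^ 'a"
  have "((\<lambda>u. u $ j) has_derivative (\<lambda>v. v $ j)) (at u)"
    by (rule bounded_linear_imp_has_derivative[OF bounded_linear_vec_nth])
  from partial_deriv_eq[OF this] show "partial_deriv i (\<lambda>u. u $ j) u = (if i = j then 1 else 0)"
    by (simp add: axis_def)
qed

lemma partial_derivs_Nil [simp]: "partial_derivs [] f = f"
  and partial_derivs_Cons: "partial_derivs (i # is) f = partial_deriv i (partial_derivs is f)"
  and partial_derivs_snoc: "partial_derivs (is @ [i]) f = partial_derivs is (partial_deriv i f)"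
  and partial_derivs_append: "partial_derivs (is @ js) f = partial_derivs is (partial_derivs js f)"
  by (simp_all add: partial_derivs_def)

section \<open>Closure properties of smooth functions\<close>

lemma smooth_partial_derivs: "smooth f \<Longrightarrow> smooth (partial_derivs is f)"
  by (simp add: smooth_def flip: partial_derivs_append)

lemma smooth_partial_deriv: "smooth f \<Longrightarrow> smooth (partial_deriv i f)"
  using smooth_partial_derivs[of f "[i]"] by (simp add: partial_derivs_Cons)

lemma smooth_differentiable: "smooth f \<Longrightarrow> f differentiable at u"
  unfolding smooth_def by (metis partial_derivs_Nil)

text \<open>Smoothness is the greatest property that implies differentiability and passes to partial
  derivatives, so an invariant of this kind suffices and no formula for iterated derivatives is
  required.\<close>

lemma smooth_coinduct:
  assumes "P f"
    and step: "\<And>f. P f \<Longrightarrow> (\<forall>u. f differentiable at u) \<and> (\<forall>i. P (partial_deriv i f))"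
  shows "smooth f"
proof -
  have "P (partial_derivs is f)" for "is"
    using assms by (induction "is") (auto simp: partial_derivs_Cons)
  then show ?thesis
    using step by (auto simp: smooth_def)
qed

lemma smooth_const [simp]: "smooth (\<lambda>u. c)"
  by (rule smooth_coinduct[where P = "\<lambda>f. \<exists>c. f = (\<lambda>u. c)"]) auto

lemma smooth_coord [simp]: "smooth (\<lambda>u. u $ j)"
proof (rule smooth_coinduct[where P = "\<lambda>f. f = (\<lambda>u. u $ j) \<or> (\<exists>c. f = (\<lambda>u. c))"])
  have "(\<lambda>u. u $ j) differentiable at u" for u :: "real ^ 'a"
    by (rule bounded_linear_imp_differentiable[OF bounded_linear_vec_nth])
  then show "\<And>f. f = (\<lambda>u. u $ j) \<or> (\<exists>c. f = (\<lambda>u. c)) \<Longrightarrow>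
    (\<forall>u. f differentiable at u) \<and> (\<forall>i. partial_deriv i f = (\<lambda>u. u $ j) \<or> (\<exists>c. partial_deriv i f = (\<lambda>u. c)))"
    by auto
qed simp

text \<open>A coinduction invariant for products: the derivative of f g is f g' + g f', so products
  alone are not preserved by differentiation, but sums of products are.\<close>

inductive sum_of_products :: "(real ^ 'k::finite \<Rightarrow> real) \<Rightarrow> bool" where
  product: "smooth f \<Longrightarrow> smooth g \<Longrightarrow> sum_of_products (\<lambda>u. f u * g u)"
| sum: "sum_of_products f \<Longrightarrow> sum_of_products g \<Longrightarrow> sum_of_products (\<lambda>u. f u + g u)"

lemma smooth_sum_of_products:
  assumes "sum_of_products f"
  shows "smooth f"
proof (rule smooth_coinduct[where P = sum_of_products, OF assms])
  fix f :: "real ^ 'a \<Rightarrow> real"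
  assume "sum_of_products f"
  then show "(\<forall>u. f differentiable at u) \<and> (\<forall>i. sum_of_products (partial_deriv i f))"
  proof induction
    case (product f g)
    then show ?case
      by (auto simp: smooth_differentiable partial_deriv_mult
          intro!: differentiable_mult sum_of_products.intros smooth_partial_deriv)
  next
    case (sum f g)
    then show ?case
      by (auto simp: partial_deriv_add intro!: differentiable_add sum_of_products.intros)
  qed
qed

lemma smooth_mult [intro]: "smooth f \<Longrightarrow> smooth g \<Longrightarrow> smooth (\<lambda>u. f u * g u)"
  by (rule smooth_sum_of_products[OF sum_of_products.product])

lemma smooth_add [intro]:
  assumes "smooth f" "smooth g"
  shows "smooth (\<lambda>u. f u + g u)"
proof -
  \<comment> \<open>The constant factors \<open>1\<close> make a plain sum an instance of the
    invariant.\<close>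
  have "sum_of_products (\<lambda>u. 1 * f u + 1 * g u)"
    using assms by (intro sum_of_products.intros smooth_const)
  then show ?thesis
    by (simp add: smooth_sum_of_products)
qed

lemma smooth_cmult [intro]: "smooth f \<Longrightarrow> smooth (\<lambda>u. c * f u)"
  by (rule smooth_mult) simp_all

lemma smooth_sum:
  assumes "\<And>i. i \<in> S \<Longrightarrow> smooth (f i)"
  shows "smooth (\<lambda>u. \<Sum>i\<in>S. f i u)"
  using assms by (induction S rule: infinite_finite_induct) auto

lemma smooth_prod:
  assumes "\<And>i. i \<in> S \<Longrightarrow> smooth (f i)"
  shows "smooth (\<lambda>u. \<Prod>i\<in>S. f i u)"
  using assms by (induction S rule: infinite_finite_induct) auto

section \<open>Equality of mixed partial derivatives\<close>

lemma has_real_derivative_along_axis: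
  assumes "smooth f"
  shows "((\<lambda>t. f (u + t *\<^sub>R axis i 1)) has_real_derivative
    partial_deriv i f (u + t *\<^sub>R axis i 1)) (at t)"
proof -
  let ?x = "u + t *\<^sub>R axis i 1" and ?D = "frechet_derivative f (at (u + t *\<^sub>R axis i 1))"
  have D: "(f has_derivative ?D) (at ?x)"
    using smooth_differentiable[OF assms] frechet_derivative_works by blast
  have "((\<lambda>t. u + t *\<^sub>R axis i 1) has_derivative (\<lambda>s. s *\<^sub>R axis i 1)) (at t)"
    by (auto intro!: derivative_eq_intros)
  from has_derivative_compose[OF this D]
  have "((\<lambda>t. f (u + t *\<^sub>R axis i 1)) has_derivative (\<lambda>s. ?D (s *\<^sub>R axis i 1))) (at t)" .
  moreover have "?D (s *\<^sub>R axis i 1) = partial_deriv i f ?x * s" for s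
    using linear_scale[OF has_derivative_linear[OF D]] by (simp add: partial_deriv_def)
  ultimately show ?thesis
    by (simp add: has_field_derivative_def)
qed

text \<open>The mean value theorem is applied twice: along axis \<open>i\<close> to the difference
  of \<open>f\<close> on two parallel segments, then along axis \<open>j\<close>. Exchanging
  \<open>i\<close> and \<open>j\<close> leaves the second difference unchanged but yields the other
  mixed derivative.\<close>

lemma second_difference_mean_value:
  assumes f: "smooth f" and "t > 0"
  obtains \<xi> \<eta> where "0 < \<xi>" "\<xi> < t" "0 < \<eta>" "\<eta> < t"
    "f (u + t *\<^sub>R axis i 1 + t *\<^sub>R axis j 1) - f (u + t *\<^sub>R axis i 1) - f (u + t *\<^sub>R axis j 1) + f u
      = t\<^sup>2 * partial_deriv j (partial_deriv i f) (u + \<xi> *\<^sub>R axis i 1 + \<eta> *\<^sub>R axis j 1)"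
proof -
  define \<phi> where "\<phi> x = f ((u + t *\<^sub>R axis j 1) + x *\<^sub>R axis i 1) - f (u + x *\<^sub>R axis i 1)" for x
  have "(\<phi> has_real_derivative
      partial_deriv i f ((u + t *\<^sub>R axis j 1) + x *\<^sub>R axis i 1) - partial_deriv i f (u + x *\<^sub>R axis i 1)) (at x)" for x
    unfolding \<phi>_def by (intro DERIV_diff has_real_derivative_along_axis f)
  from MVT2[OF \<open>t > 0\<close> this] obtain \<xi> where \<xi>: "0 < \<xi>" "\<xi> < t"
    "\<phi> t - \<phi> 0 = t * (partial_deriv i f ((u + t *\<^sub>R axis j 1) + \<xi> *\<^sub>R axis i 1) - partial_deriv i f (u + \<xi> *\<^sub>R axis i 1))"
    by auto
  have "((\<lambda>y. partial_deriv i f ((u + \<xi> *\<^sub>R axis i 1) + y *\<^sub>R axis j 1)) has_real_derivative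
      partial_deriv j (partial_deriv i f) (u + \<xi> *\<^sub>R axis i 1 + y *\<^sub>R axis j 1)) (at y)" for y
    by (rule has_real_derivative_along_axis[OF smooth_partial_deriv[OF f]])
  from MVT2[OF \<open>t > 0\<close> this]
  obtain \<eta> where \<eta>: "0 < \<eta>" "\<eta> < t"
    "partial_deriv i f ((u + \<xi> *\<^sub>R axis i 1) + t *\<^sub>R axis j 1) - partial_deriv i f (u + \<xi> *\<^sub>R axis i 1)
      = t * partial_deriv j (partial_deriv i f) (u + \<xi> *\<^sub>R axis i 1 + \<eta> *\<^sub>R axis j 1)"
    by auto
  show ?thesis
    using \<xi> \<eta> by (intro that[of \<xi> \<eta>]) (auto simp: \<phi>_def power2_eq_square algebra_simps)
qed

text \<open>By symmetry of the second difference, the two mixed derivatives take a common value, at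
  two points as close to \<open>u\<close> as desired; continuity carries this over to
  \<open>u\<close>.\<close>

lemma partial_deriv_commute:
  assumes f: "smooth f"
  shows "partial_deriv i (partial_deriv j f) = partial_deriv j (partial_deriv i f)"
proof (rule ccontr)
  let ?a = "partial_deriv i (partial_deriv j f)" and ?b = "partial_deriv j (partial_deriv i f)"
  assume "?a \<noteq> ?b"
  then obtain u where u: "?a u \<noteq> ?b u" by auto
  define e where "e = \<bar>?a u - ?b u\<bar> / 2"
  have e: "e > 0" using u by (simp add: e_def)
  have cont: "isCont ?a u" "isCont ?b u"
    by (intro differentiable_imp_continuous_within smooth_differentiable smooth_partial_deriv f)+
  obtain d where d: "d > 0" "\<And>x. dist x u < d \<Longrightarrow> dist (?a x) (?a u) < e"
    using cont(1) e unfolding continuous_at_eps_delta by blast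
  obtain d' where d': "d' > 0" "\<And>x. dist x u < d' \<Longrightarrow> dist (?b x) (?b u) < e"
    using cont(2) e unfolding continuous_at_eps_delta by blast
  \<comment> \<open>The points supplied by the mean value argument have distance at most \<xi> +
    \<eta> < 2 t from \<open>u\<close>.\<close>
  define t where "t = min d d' / 2"
  have t: "t > 0" using d d' by (simp add: t_def)
  have near: "dist (u + \<xi> *\<^sub>R axis p 1 + \<eta> *\<^sub>R axis q 1) u < min d d'"
    if "0 < \<xi>" "\<xi> < t" "0 < \<eta>" "\<eta> < t" for \<xi> \<eta> and p q :: 'a
  proof -
    have "dist (u + \<xi> *\<^sub>R axis p 1 + \<eta> *\<^sub>R axis q 1) u = norm (\<xi> *\<^sub>R axis p 1 + \<eta> *\<^sub>R axis q (1::real))"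
      by (simp add: dist_norm)
    also have "\<dots> \<le> \<xi> + \<eta>"
      using that by (intro norm_triangle_le) simp
    finally show ?thesis using that by (simp add: t_def)
  qed
  obtain \<xi> \<eta> where 1: "0 < \<xi>" "\<xi> < t" "0 < \<eta>" "\<eta> < t"
    "f (u + t *\<^sub>R axis i 1 + t *\<^sub>R axis j 1) - f (u + t *\<^sub>R axis i 1) - f (u + t *\<^sub>R axis j 1) + f u
      = t\<^sup>2 * ?b (u + \<xi> *\<^sub>R axis i 1 + \<eta> *\<^sub>R axis j 1)"
    using second_difference_mean_value[OF f t] by blast
  obtain \<xi>' \<eta>' where 2: "0 < \<xi>'" "\<xi>' < t" "0 < \<eta>'" "\<eta>' < t"
    "f (u + t *\<^sub>R axis j 1 + t *\<^sub>R axis i 1) - f (u + t *\<^sub>R axis j 1) - f (u + t *\<^sub>R axis i 1) + f u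
      = t\<^sup>2 * ?a (u + \<xi>' *\<^sub>R axis j 1 + \<eta>' *\<^sub>R axis i 1)"
    using second_difference_mean_value[OF f t] by blast
  have "t\<^sup>2 * ?a (u + \<xi>' *\<^sub>R axis j 1 + \<eta>' *\<^sub>R axis i 1) = t\<^sup>2 * ?b (u + \<xi> *\<^sub>R axis i 1 + \<eta> *\<^sub>R axis j 1)"
    unfolding 1(5)[symmetric] 2(5)[symmetric] by (simp add: algebra_simps)
  then have "?a (u + \<xi>' *\<^sub>R axis j 1 + \<eta>' *\<^sub>R axis i 1) = ?b (u + \<xi> *\<^sub>R axis i 1 + \<eta> *\<^sub>R axis j 1)"
    using t by simp
  moreover have "dist (?a (u + \<xi>' *\<^sub>R axis j 1 + \<eta>' *\<^sub>R axis i 1)) (?a u) < e"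
    using near[OF 2(1-4)] by (intro d) simp
  moreover have "dist (?b (u + \<xi> *\<^sub>R axis i 1 + \<eta> *\<^sub>R axis j 1)) (?b u) < e"
    using near[OF 1(1-4)] by (intro d') simp
  ultimately have "dist (?a u) (?b u) < e + e"
    by (metis add_strict_mono dist_commute dist_triangle le_less_trans)
  then show False
    by (simp add: e_def dist_real_def)
qed

lemma partial_derivs_mset_cong:
  assumes f: "smooth f" and "mset is = mset js"
  shows "partial_derivs is f = partial_derivs js f"
  using assms(2)
proof (induction "is" arbitrary: js)
  case (Cons i "is")
  then have "i \<in> set js"
    by (metis list.set_intros(1) mset_eq_setD)
  then obtain as bs where js: "js = as @ i # bs"
    by (meson split_list)
  have "partial_derivs (as @ i # bs) f = partial_deriv i (partial_derivs (as @ bs) f)"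
  proof (induction as)
    case (Cons a as)
    then show ?case
      by (simp add: partial_derivs_Cons partial_deriv_commute[of _ a] smooth_partial_derivs f)
  qed (simp add: partial_derivs_Cons)
  moreover have "partial_derivs is f = partial_derivs (as @ bs) f"
    using Cons.prems js by (intro Cons.IH) simp
  ultimately show ?case
    by (simp add: js partial_derivs_Cons)
qed simp

section \<open>Multi-index derivatives and the jet relation\<close>

text \<open>Multi-indices are multisets of coordinate indices.\<close>

definition mderiv :: "'k::finite multiset \<Rightarrow> (real ^ 'k \<Rightarrow> real) \<Rightarrow> real ^ 'k \<Rightarrow> real"
  where "mderiv M = partial_derivs (SOME is. mset is = M)"

lemma mderiv_mset:
  assumes "smooth f"
  shows "mderiv (mset is) f = partial_derivs is f"
proof -
  have "mset (SOME js. mset js = mset is) = mset is"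
    by (rule someI[where x = "is"]) simp
  then show ?thesis
    unfolding mderiv_def by (intro partial_derivs_mset_cong assms)
qed

lemma mderiv_empty [simp]: "mderiv {#} f = f"
  by (simp add: mderiv_def)

text \<open>By symmetry the derivative split off may be the innermost one. It then acts on the
  function, so inductions on \<open>M\<close> go through with the function generalised.\<close>

lemma mderiv_add_mset:
  assumes "smooth f"
  shows "mderiv (add_mset i M) f = mderiv M (partial_deriv i f)"
proof -
  obtain "is" where M: "M = mset is" by (metis ex_mset)
  have "mderiv (mset (is @ [i])) f = mderiv (mset is) (partial_deriv i f)"
    unfolding mderiv_mset[OF assms] mderiv_mset[OF smooth_partial_deriv[OF assms]]
    by (rule partial_derivs_snoc)
  then show ?thesis by (simp add: M)
qed

lemma mderiv_const: "mderiv M (\<lambda>u. c) = (\<lambda>u. if M = {#} then c else 0)"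
  by (induction M arbitrary: c) (auto simp: mderiv_add_mset)

lemma mderiv_add:
  assumes "smooth f" "smooth g"
  shows "mderiv M (\<lambda>u. f u + g u) = (\<lambda>u. mderiv M f u + mderiv M g u)"
  using assms
  by (induction M arbitrary: f g)
    (simp_all add: mderiv_add_mset smooth_add partial_deriv_add smooth_differentiable smooth_partial_deriv)

lemma mderiv_cmult:
  assumes "smooth f"
  shows "mderiv M (\<lambda>u. c * f u) = (\<lambda>u. c * mderiv M f u)"
  using assms
  by (induction M arbitrary: f)
    (simp_all add: mderiv_add_mset smooth_cmult partial_deriv_mult smooth_differentiable smooth_partial_deriv)

lemma mderiv_sum:
  assumes "\<And>i. i \<in> S \<Longrightarrow> smooth (f i)"
  shows "mderiv M (\<lambda>u. \<Sum>i\<in>S. f i u) = (\<lambda>u. \<Sum>i\<in>S. mderiv M (f i) u)"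
  using assms
  by (induction S rule: infinite_finite_induct) (simp_all add: mderiv_add smooth_sum mderiv_const)

text \<open>Every other term of the Leibniz expansion leaves a derivative of order below
  \<open>size M\<close> on \<open>f\<close>, which vanishes at \<open>0\<close>. This gives both the
  ideal property of null jets and the leading term in \<open>coeff_form_null\<close>.\<close>

lemma mderiv_mult_vanishing:
  assumes "smooth h" "smooth f" and "\<And>N. size N < size M \<Longrightarrow> mderiv N f 0 = 0"
  shows "mderiv M (\<lambda>u. h u * f u) 0 = h 0 * mderiv M f 0"
  using assms
proof (induction M arbitrary: h f)
  case (add i M)
  have f: "mderiv N f 0 = 0" if "size N \<le> size M" for N
    using add.prems(3)[of N] that by simp
  have "mderiv N (partial_deriv i f) 0 = 0" if "size N < size M" for N
    using add.prems(3)[of "add_mset i N"] that add.prems(2) by (simp add: mderiv_add_mset)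
  then have "mderiv M (\<lambda>u. h u * partial_deriv i f u) 0 = h 0 * mderiv M (partial_deriv i f) 0"
    using add.prems by (intro add.IH smooth_partial_deriv)
  \<comment> \<open>Where \<open>h\<close> is differentiated, \<open>mderiv M f 0\<close> is itself
    \<open>0\<close>, by the hypothesis for the larger multi-index.\<close>
  moreover have "mderiv M (\<lambda>u. partial_deriv i h u * f u) 0 = partial_deriv i h 0 * mderiv M f 0"
    using add.prems f by (intro add.IH smooth_partial_deriv) auto
  moreover have "mderiv (add_mset i M) (\<lambda>u. h u * f u)
      = mderiv M (\<lambda>u. h u * partial_deriv i f u + partial_deriv i h u * f u)"
    using add.prems(1,2)
    by (simp add: mderiv_add_mset smooth_mult partial_deriv_mult smooth_differentiable
        mult.commute[of "f _" "partial_deriv i h _"])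
  ultimately show ?case
    using add.prems(1,2) f[of M]
    by (simp add: mderiv_add_mset smooth_mult mderiv_add smooth_partial_deriv)
qed simp

lemma mem_jet_rel_iff:
  "(f, g) \<in> jet_rel r \<longleftrightarrow> smooth f \<and> smooth g \<and> (\<forall>M. size M \<le> r \<longrightarrow> mderiv M f 0 = mderiv M g 0)"
proof -
  have "(\<forall>is. length is \<le> r \<longrightarrow> partial_derivs is f 0 = partial_derivs is g 0) \<longleftrightarrow>
      (\<forall>M. size M \<le> r \<longrightarrow> mderiv M f 0 = mderiv M g 0)" if "smooth f" "smooth g"
  proof (intro iffI allI impI)
    fix M :: "'a multiset"
    assume *: "\<forall>is. length is \<le> r \<longrightarrow> partial_derivs is f 0 = partial_derivs is g 0" and "size M \<le> r"
    moreover obtain "is" where "M = mset is" by (metis ex_mset)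
    ultimately show "mderiv M f 0 = mderiv M g 0"
      by (simp add: mderiv_mset that)
  next
    fix "is" :: "'a list"
    assume *: "\<forall>M. size M \<le> r \<longrightarrow> mderiv M f 0 = mderiv M g 0" and "length is \<le> r"
    then have "mderiv (mset is) f 0 = mderiv (mset is) g 0" by simp
    then show "partial_derivs is f 0 = partial_derivs is g 0"
      by (simp add: mderiv_mset that)
  qed
  then show ?thesis by (auto simp: jet_rel_def)
qed

section \<open>Monomials and Taylor polynomials\<close>

definition monomial :: "'k multiset \<Rightarrow> real ^ 'k \<Rightarrow> real"
  where "monomial M u = (\<Prod>i\<in>#M. u $ i)"

text \<open>The multi-index factorial; dividing by it makes the monomials dual to the derivatives at
  \<open>0\<close>.\<close>

definition mfact :: "'k::finite multiset \<Rightarrow> real"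
  where "mfact M = (\<Prod>i\<in>UNIV. fact (count M i))"

lemma monomial_empty [simp]: "monomial {#} = (\<lambda>u. 1)"
  by (simp add: monomial_def fun_eq_iff)

lemma monomial_add_mset: "monomial (add_mset i M) = (\<lambda>u. u $ i * monomial M u)"
  by (simp add: monomial_def fun_eq_iff)

lemma smooth_monomial [simp]: "smooth (monomial M)"
  by (induction M) (auto simp: monomial_add_mset)

lemma mfact_pos: "mfact M > 0"
  by (simp add: mfact_def prod_pos)

lemma mfact_empty [simp]: "mfact {#} = 1"
  by (simp add: mfact_def)

lemma mfact_add_mset: "mfact (add_mset i M) = (real (count M i) + 1) * mfact M"
proof -
  have *: "mfact N = fact (count N i) * (\<Prod>j\<in>UNIV - {i}. fact (count N j))" for N :: "'a multiset"
    unfolding mfact_def by (rule prod.remove) simp_all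
  have "(\<Prod>j\<in>UNIV - {i}. fact (count (add_mset i M) j)) = (\<Prod>j\<in>UNIV - {i}. fact (count M j) :: real)"
    by (intro prod.cong) auto
  then show ?thesis
    unfolding *[of M] *[of "add_mset i M"] by (simp add: algebra_simps)
qed

text \<open>If \<open>i\<close> does not occur in \<open>M\<close>, then \<open>M - {#i#}\<close> is
  \<open>M\<close> itself, but the factor \<open>count M i\<close> is \<open>0\<close>.\<close>

lemma partial_deriv_monomial:
  "partial_deriv i (monomial M) = (\<lambda>u. real (count M i) * monomial (M - {#i#}) u)"
proof (induction M)
  case (add j M)
  have "partial_deriv i (monomial (add_mset j M))
      = (\<lambda>u. u $ j * (real (count M i) * monomial (M - {#i#}) u) + monomial M u * (if i = j then 1 else 0))"
    unfolding monomial_add_mset by (subst partial_deriv_mult) (simp_all add: smooth_differentiable add.IH)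
  also have "\<dots> = (\<lambda>u. real (count (add_mset j M) i) * monomial (add_mset j M - {#i#}) u)"
  proof (cases "i \<in># M")
    case True
    then obtain K where "M = add_mset i K" by (metis insert_DiffM)
    then show ?thesis by (auto simp: monomial_add_mset algebra_simps)
  next
    case False
    then show ?thesis by (auto simp: not_in_iff)
  qed
  finally show ?case .
qed simp

lemma mderiv_monomial_0: "mderiv N (monomial M) 0 = (if N = M then mfact M else 0)"
proof (induction N arbitrary: M)
  case empty
  then show ?case
    by (cases M) (auto simp: monomial_add_mset)
next
  case (add i N)
  have "mderiv (add_mset i N) (monomial M) 0 = count M i * mderiv N (monomial (M - {#i#})) 0"
    by (simp add: mderiv_add_mset partial_deriv_monomial mderiv_cmult)
  also have "\<dots> = (if add_mset i N = M then mfact M else 0)"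
  proof (cases "i \<in># M")
    case True
    then obtain K where "M = add_mset i K" by (metis insert_DiffM)
    then show ?thesis by (simp add: add.IH mfact_add_mset)
  next
    case False
    then show ?thesis by (auto simp: not_in_iff)
  qed
  finally show ?case .
qed

lemma finite_multisets_size:
  fixes S :: "'a set"
  assumes "finite S"
  shows "finite {M. set_mset M \<subseteq> S \<and> size M = n}"
proof (rule finite_subset)
  show "{M. set_mset M \<subseteq> S \<and> size M = n} \<subseteq> mset ` {xs. set xs \<subseteq> S \<and> length xs = n}"
  proof
    fix M assume "M \<in> {M. set_mset M \<subseteq> S \<and> size M = n}"
    moreover obtain xs where "M = mset xs" by (metis ex_mset)
    ultimately show "M \<in> mset ` {xs. set xs \<subseteq> S \<and> length xs = n}" by auto
  qed
  show "finite (mset ` {xs. set xs \<subseteq> S \<and> length xs = n})"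
    using assms by (simp add: finite_lists_length_eq)
qed

lemma finite_multisets_size_le: "finite {M :: 'k::finite multiset. size M \<le> n}"
proof -
  have "{M :: 'k multiset. size M \<le> n} = (\<Union>m\<le>n. {M. set_mset M \<subseteq> UNIV \<and> size M = m})"
    by auto
  moreover have "finite (\<Union>m\<le>n. {M :: 'k multiset. set_mset M \<subseteq> UNIV \<and> size M = m})"
    by (intro finite_UN_I finite_atMost finite_multisets_size finite)
  ultimately show ?thesis by metis
qed

text \<open>The duality of monomials and derivatives gives the Taylor polynomial the prescribed
  derivatives. Hence jets of monomials span, and claims on arbitrary smooth arguments reduce to
  monomials.\<close>

lemma taylor_jet:
  assumes "smooth f"
  shows "(f, \<lambda>u. \<Sum>M | size M \<le> r. mderiv M f 0 / mfact M * monomial M u) \<in> jet_rel r"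
proof -
  have "mderiv N (\<lambda>u. \<Sum>M | size M \<le> r. mderiv M f 0 / mfact M * monomial M u) 0 = mderiv N f 0"
    if "size N \<le> r" for N
  proof -
    have "mderiv N (\<lambda>u. \<Sum>M | size M \<le> r. mderiv M f 0 / mfact M * monomial M u) 0
        = (\<Sum>M | size M \<le> r. mderiv M f 0 / mfact M * mderiv N (monomial M) 0)"
      by (subst mderiv_sum) (auto intro!: smooth_cmult simp only: mderiv_cmult smooth_monomial)
    also have "\<dots> = (\<Sum>M | size M \<le> r. if M = N then mderiv N f 0 else 0)"
      using mfact_pos[of N] by (intro sum.cong) (auto simp: mderiv_monomial_0)
    also have "\<dots> = mderiv N f 0"
      using that by (simp add: finite_multisets_size_le)
    finally show ?thesis .
  qed
  moreover have "smooth (\<lambda>u. \<Sum>M | size M \<le> r. mderiv M f 0 / mfact M * monomial M u)"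
    by (intro smooth_sum smooth_cmult smooth_monomial)
  ultimately show ?thesis
    using assms by (simp add: mem_jet_rel_iff)
qed

section \<open>Counting index pairs; alternating coefficients\<close>

text \<open>Stars and bars, by Pascal's rule: a multiset over \<open>insert x S\<close> either
  avoids \<open>x\<close> or is a smaller one with one more \<open>x\<close>.\<close>

lemma card_multisets_size:
  assumes "finite S"
  shows "card {M. set_mset M \<subseteq> S \<and> size M = n} = (card S + n - 1) choose n"
  using assms
proof (induction S arbitrary: n rule: finite_induct)
  \<comment> \<open>Truncated subtraction gives the right values: \<open>0 choose 0\<close> for
    \<open>n = 0\<close>, and \<open>(n - 1) choose n\<close>, which is \<open>0\<close>,
    otherwise.\<close>
  case empty
  have "{M :: 'a multiset. set_mset M \<subseteq> {} \<and> size M = n} = (if n = 0 then {{#}} else {})"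
    by auto
  then have "card {M :: 'a multiset. set_mset M \<subseteq> {} \<and> size M = n} = (if n = 0 then 1 else 0)"
    by (simp only:) simp
  then show ?case by simp
next
  case (insert x S)
  show ?case
  proof (induction n)
    case 0
    have "{M. set_mset M \<subseteq> insert x S \<and> size M = 0} = {{#}}"
      by auto
    then show ?case by simp
  next
    case (Suc n)
    have fin: "finite {M. set_mset M \<subseteq> insert x S \<and> size M = n}" "finite {M. set_mset M \<subseteq> S \<and> size M = Suc n}"
      using insert.hyps by (simp_all add: finite_multisets_size)
    have "{M. set_mset M \<subseteq> insert x S \<and> size M = Suc n}
        = {M. set_mset M \<subseteq> S \<and> size M = Suc n} \<union> add_mset x ` {M. set_mset M \<subseteq> insert x S \<and> size M = n}"
    proof (intro equalityI subsetI)
      fix M assume M: "M \<in> {M. set_mset M \<subseteq> insert x S \<and> size M = Suc n}"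
      show "M \<in> {M. set_mset M \<subseteq> S \<and> size M = Suc n} \<union> add_mset x ` {M. set_mset M \<subseteq> insert x S \<and> size M = n}"
      proof (cases "x \<in># M")
        case True
        then obtain K where "M = add_mset x K" by (metis insert_DiffM)
        then show ?thesis using M by auto
      next
        case False
        then show ?thesis using M by auto
      qed
    qed (use insert.hyps in auto)
    then have "card {M. set_mset M \<subseteq> insert x S \<and> size M = Suc n}
        = card {M. set_mset M \<subseteq> S \<and> size M = Suc n} + card {M. set_mset M \<subseteq> insert x S \<and> size M = n}"
      using fin insert.hyps(2) by (simp, subst card_Un_disjoint) (auto simp: card_image inj_on_def)
    then show ?case
      using insert.hyps by (simp add: insert.IH Suc.IH)
  qed
qed

lemma card_multisets_size_le:
  "card {M :: 'k::finite multiset. size M \<le> n} = (CARD('k) + n) choose n"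
proof -
  \<comment> \<open>Removes the truncated subtraction, so that the sum takes the form of the
    hockey-stick identity \<open>sum_choose_lower\<close>.\<close>
  obtain m where m: "CARD('k) = Suc m"
    by (metis card_0_eq finite UNIV_not_empty not0_implies_Suc)
  have "{M :: 'k multiset. size M \<le> n} = (\<Union>i\<in>{..n}. {M. set_mset M \<subseteq> UNIV \<and> size M = i})"
    by auto
  also have "card \<dots> = (\<Sum>i\<le>n. card {M :: 'k multiset. set_mset M \<subseteq> UNIV \<and> size M = i})"
    by (rule card_UN_disjoint) (use finite_multisets_size[of "UNIV :: 'k set"] in auto)
  also have "\<dots> = (\<Sum>i\<le>n. (m + i) choose i)"
    by (intro sum.cong refl) (subst card_multisets_size, simp_all add: m)
  also have "\<dots> = (CARD('k) + n) choose n"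
    by (simp add: sum_choose_lower m)
  finally show ?thesis .
qed

text \<open>Both sides are (q + n)! / (q! s! (n - s)!), and both vanish for s > n. It gives the two
  kinds of pairs the same first factor.\<close>

lemma trinomial_revision: "((q + s) choose s) * ((q + n) choose (q + s)) = (n choose s) * ((n + q) choose q)"
proof (cases "s \<le> n")
  case True
  have "((q + n) choose (q + s)) * ((q + s) choose q) = ((q + n) choose q) * ((q + n - q) choose (q + s - q))"
    by (rule choose_mult) (use True in auto)
  moreover have "(q + s) choose q = (q + s) choose s"
    using binomial_symmetric[of q "q + s"] by simp
  ultimately show ?thesis by (simp add: ac_simps)
qed (simp add: binomial_eq_0)

text \<open>For injective \<open>f\<close> and positive \<open>r\<close> these are the semistandard
  tableaux of hook shape (r, 1^s), for the reverse of the order given by \<open>f\<close>: the row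
  is \<open>M\<close>, the column is the maximum of \<open>M\<close> followed by
  \<open>I\<close>.\<close>

definition hook_pairs :: "('a \<Rightarrow> nat) \<Rightarrow> nat \<Rightarrow> nat \<Rightarrow> 'a set \<Rightarrow> ('a set \<times> 'a multiset) set"
  where "hook_pairs f r s S = {(I, M). I \<subseteq> S \<and> card I = s \<and> set_mset M \<subseteq> S \<and> size M = r \<and>
    (\<exists>j\<in>#M. \<forall>i\<in>I. f i < f j)}"

lemma finite_hook_pairs:
  assumes "finite S"
  shows "finite (hook_pairs f r s S)"
proof (rule finite_subset)
  show "hook_pairs f r s S \<subseteq> Pow S \<times> {M. set_mset M \<subseteq> S \<and> size M = r}"
    by (auto simp: hook_pairs_def)
qed (use assms in \<open>simp add: finite_multisets_size\<close>)

text \<open>\<open>S\<close> grows by elements \<open>x\<close> of increasing rank. The new maximum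
  cannot lie in \<open>I\<close>. If it lies in \<open>M\<close>, the condition holds automatically,
  so \<open>I\<close> is any \<open>s\<close>-subset of the old \<open>S\<close> and the rest of
  \<open>M\<close> is arbitrary.\<close>

lemma card_hook_pairs:
  assumes "finite S" "inj_on f S"
  shows "card (hook_pairs f (Suc q) s S) = ((q + s) choose s) * ((q + card S) choose (Suc q + s))"
  using assms
proof (induction S rule: finite_ranking_induct[where f = f])
  case empty
  have "hook_pairs f (Suc q) s {} = {}"
    by (auto simp: hook_pairs_def)
  then show ?case by simp
next
  case (insert x S)
  show ?case
  proof (cases "x \<in> S")
    case True
    then show ?thesis using insert by (simp add: insert_absorb)
  next
    case x: False
    have less: "f y < f x" if "y \<in> S" for y
      using insert.hyps(2)[OF that] insert.prems that x by (metis inj_onD insertI1 insertI2 le_neq_implies_less)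
    let ?Q = "hook_pairs f (Suc q) s S" and ?I = "{I. I \<subseteq> S \<and> card I = s}"
      and ?N = "{N. set_mset N \<subseteq> insert x S \<and> size N = q}"
    have "hook_pairs f (Suc q) s (insert x S) = ?Q \<union> ?I \<times> add_mset x ` ?N"
    proof (intro equalityI subsetI)
      fix p assume "p \<in> hook_pairs f (Suc q) s (insert x S)"
      then obtain I M j where p: "p = (I, M)" "I \<subseteq> insert x S" "card I = s" "set_mset M \<subseteq> insert x S"
        "size M = Suc q" "j \<in># M" "\<forall>i\<in>I. f i < f j"
        by (auto simp: hook_pairs_def)
      have "f j \<le> f x" using p(4,6) less by (metis insert_iff le_less subsetD)
      then have "x \<notin> I" using p(7) by auto
      then have I: "I \<subseteq> S" using p(2) by auto
      show "p \<in> ?Q \<union> ?I \<times> add_mset x ` ?N"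
      proof (cases "x \<in># M")
        case True
        then obtain N where "M = add_mset x N" by (metis insert_DiffM)
        then show ?thesis using p I by auto
      next
        case False
        then show ?thesis using p I by (auto simp: hook_pairs_def)
      qed
    next
      fix p assume "p \<in> ?Q \<union> ?I \<times> add_mset x ` ?N"
      moreover have "\<exists>j\<in>#add_mset x N. \<forall>i\<in>I. f i < f j" if "I \<subseteq> S" for I N
        using that less by auto
      ultimately show "p \<in> hook_pairs f (Suc q) s (insert x S)"
        by (auto simp: hook_pairs_def)
    qed
    moreover have "?Q \<inter> ?I \<times> add_mset x ` ?N = {}"
      using x by (auto simp: hook_pairs_def)
    moreover have "finite ?I" "finite ?N"
      using insert.hyps by (auto simp: finite_multisets_size)
    ultimately have "card (hook_pairs f (Suc q) s (insert x S)) = card ?Q + card ?I * card ?N"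
      using insert.hyps by (simp add: card_Un_disjoint finite_hook_pairs card_cartesian_product card_image inj_on_def)
    also have "\<dots> = ((q + s) choose s) * ((q + card S) choose (Suc q + s)) + (card S choose s) * ((card S + q) choose q)"
      using insert x by (simp add: card_multisets_size n_subsets inj_on_def)
    \<comment> \<open>\<open>trinomial_revision\<close> gives the second summand the factor
      \<open>(q + s) choose s\<close>; Pascal's rule remains.\<close>
    also have "\<dots> = ((q + s) choose s) * ((q + card (insert x S)) choose (Suc q + s))"
      using insert.hyps(1) x trinomial_revision[of q s "card S"] by (simp add: algebra_simps)
    finally show ?thesis .
  qed
qed

section \<open>Alternating coefficients on lists of indices\<close>

text \<open>The coefficient of a list \<open>I\<close> in the wedge product of the basis covectors indexed by \<open>L\<close>.\<close>

definition wedge_coeff :: "'a list \<Rightarrow> 'a list \<Rightarrow> real"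
  where "wedge_coeff L I = (\<Sum>p | p permutes {..<length L}. of_int (sign p) * (if permute_list p I = L then 1 else 0))"

lemma swap_eq_permute_list:
  assumes "i < length I" "j < length I"
  shows "I[i := I ! j, j := I ! i] = permute_list (Transposition.transpose i j) I"
  using assms
  by (intro nth_equalityI)
    (auto simp: permute_list_nth permutes_swap_id nth_list_update Transposition.transpose_def)

text \<open>Composing the summation index with the transposition permutes the summands and flips
  every sign.\<close>

lemma wedge_coeff_swap:
  assumes "length I = length L" "i < length L" "j < length L" "i \<noteq> j"
  shows "wedge_coeff L (I[i := I ! j, j := I ! i]) = - wedge_coeff L I"
proof -
  let ?t = "Transposition.transpose i j" and ?S = "{..<length L}"
  have t: "?t permutes ?S" using assms by (simp add: permutes_swap_id)
  have "wedge_coeff L (I[i := I ! j, j := I ! i])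
      = (\<Sum>p | p permutes ?S. - (of_int (sign (?t \<circ> p)) * (if permute_list (?t \<circ> p) I = L then 1 else 0)))"
    unfolding wedge_coeff_def
  proof (intro sum.cong refl)
    fix p assume "p \<in> {p. p permutes ?S}"
    then have p: "p permutes ?S" by simp
    have "sign (?t \<circ> p) = - sign p"
      using assms p t by (simp add: sign_compose permutes_imp_permutation[of ?S] sign_swap_id)
    moreover have "permute_list p (I[i := I ! j, j := I ! i]) = permute_list (?t \<circ> p) I"
      using assms p by (simp add: swap_eq_permute_list permute_list_compose)
    ultimately show "of_int (sign p) * (if permute_list p (I[i := I ! j, j := I ! i]) = L then 1 else 0)
        = - (of_int (sign (?t \<circ> p)) * (if permute_list (?t \<circ> p) I = L then 1 else (0::real)))"
      by simp
  qed
  also have "\<dots> = - wedge_coeff L I"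
    unfolding wedge_coeff_def sum_negf
    by (rule arg_cong[where f = uminus, OF setum_permutations_compose_left[OF t, symmetric]])
  finally show ?thesis .
qed

lemma wedge_coeff_self:
  assumes "distinct L"
  shows "wedge_coeff L L = 1"
proof -
  have "p = id" if p: "p permutes {..<length L}" and "permute_list p L = L" for p
  proof
    fix i
    show "p i = id i"
    proof (cases "i < length L")
      case True
      then have "L ! p i = L ! i" "p i < length L"
        using permute_list_nth[OF p, of i] permutes_in_image[OF p, of i] that(2) by auto
      then show ?thesis using True assms by (simp add: nth_eq_iff_index_eq)
    next
      case False
      then show ?thesis using p by (simp add: permutes_def)
    qed
  qed
  then have "wedge_coeff L L = (\<Sum>p | p permutes {..<length L}. if p = id then 1 else 0)"
    unfolding wedge_coeff_def by (intro sum.cong) auto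
  also have "\<dots> = 1"
    by (simp add: finite_permutations permutes_id)
  finally show ?thesis .
qed

lemma wedge_coeff_support:
  assumes "wedge_coeff L I \<noteq> 0" "length I = length L"
  shows "mset I = mset L"
proof -
  obtain p where "p permutes {..<length L}" "permute_list p I = L"
    using assms(1) unfolding wedge_coeff_def
    by (elim sum.not_neutral_contains_not_neutral) (auto split: if_splits)
  then show ?thesis using assms(2) mset_permute_list by metis
qed

text \<open>Transpositions generate all permutations. The swap premise speaks only of rearrangements
  of \<open>ys\<close>, which makes facts such as the length available when it is
  discharged.\<close>

lemma swap_invariant_mset:
  assumes "mset xs = mset ys" "P ys"
    and swap: "\<And>zs i j. \<lbrakk>P zs; mset zs = mset ys; i < length zs; j < length zs; i \<noteq> j\<rbrakk>
      \<Longrightarrow> P (zs[i := zs ! j, j := zs ! i])"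
  shows "P xs"
proof -
  obtain p where p: "p permutes {..<length ys}" "permute_list p ys = xs"
    using mset_eq_permutation[OF assms(1)] by blast
  have "P (permute_list p ys)"
    using finite_lessThan p(1)
  proof (induction rule: permutes_rev_induct)
    case id
    then show ?case using assms(2) by (simp add: id_def)
  next
    case (swap a b p)
    have "permute_list (p \<circ> Transposition.transpose a b) ys = permute_list (Transposition.transpose a b) (permute_list p ys)"
      by (rule permute_list_compose) (use swap in \<open>simp add: permutes_swap_id\<close>)
    also have "\<dots> = (permute_list p ys)[a := permute_list p ys ! b, b := permute_list p ys ! a]"
      by (rule swap_eq_permute_list[symmetric]) (use swap in auto)
    finally have eq: "permute_list (p \<circ> Transposition.transpose a b) ys = \<dots>" .
    show ?case
      unfolding eq by (rule assms(3)) (use swap in auto)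
  qed
  then show ?thesis using p by simp
qed

text \<open>Lists are grouped by forgetting entry \<open>t\<close>; the marker \<open>k\<close> put
  there is arbitrary. This isolates the sum over one slot index, to which the cocycle condition
  applies.\<close>

lemma list_update_fibres:
  fixes \<phi> :: "'k::finite list \<Rightarrow> real"
  assumes "t < s"
  shows "(\<Sum>I | length I = s. \<phi> I) = (\<Sum>J | length J = s \<and> J ! t = k. \<Sum>i\<in>UNIV. \<phi> (J[t := i]))"
proof -
  let ?S = "{I :: 'k list. length I = s}"
  have fin: "finite ?S" using finite_lists_length_eq[of "UNIV :: 'k set" s] by simp
  have "(\<Sum>I\<in>?S. \<phi> I) = (\<Sum>J\<in>(\<lambda>I. I[t := k]) ` ?S. \<Sum>I | I \<in> ?S \<and> I[t := k] = J. \<phi> I)"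
    by (rule sum.image_gen[OF fin])
  also have "(\<lambda>I. I[t := k]) ` ?S = {J. length J = s \<and> J ! t = k}"
  proof (intro equalityI subsetI)
    fix J assume "J \<in> {J. length J = s \<and> J ! t = k}"
    then have "J = J[t := k]" "J \<in> ?S" by auto
    then show "J \<in> (\<lambda>I. I[t := k]) ` ?S" by blast
  qed (use assms in auto)
  also have "(\<Sum>J | length J = s \<and> J ! t = k. \<Sum>I | I \<in> ?S \<and> I[t := k] = J. \<phi> I)
      = (\<Sum>J | length J = s \<and> J ! t = k. \<Sum>i\<in>UNIV. \<phi> (J[t := i]))"
  proof (intro sum.cong refl)
    fix J assume J: "J \<in> {J. length J = s \<and> J ! t = k}"
    have "{I. I \<in> ?S \<and> I[t := k] = J} = range (\<lambda>i. J[t := i])"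
    proof (intro equalityI subsetI)
      fix I assume "I \<in> {I. I \<in> ?S \<and> I[t := k] = J}"
      then have "I = J[t := I ! t]" by auto
      then show "I \<in> range (\<lambda>i. J[t := i])" by blast
    qed (use J in auto)
    moreover have "inj (\<lambda>i. J[t := i])"
      using J assms by (metis (mono_tags, lifting) injI mem_Collect_eq nth_list_update_eq)
    ultimately show "(\<Sum>I | I \<in> ?S \<and> I[t := k] = J. \<phi> I) = (\<Sum>i\<in>UNIV. \<phi> (J[t := i]))"
      by (simp add: sum.reindex)
  qed
  finally show ?thesis .
qed

section \<open>Jets and forms on representatives\<close>

lemma jet_rel_refl: "smooth f \<Longrightarrow> (f, f) \<in> jet_rel r"
  by (simp add: mem_jet_rel_iff)

lemma jet_rel_smooth: "(f, g) \<in> jet_rel r \<Longrightarrow> smooth f" "(f, g) \<in> jet_rel r \<Longrightarrow> smooth g"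
  by (simp_all add: mem_jet_rel_iff)

lemma jet_rel_add:
  "(f, f') \<in> jet_rel r \<Longrightarrow> (g, g') \<in> jet_rel r \<Longrightarrow> (\<lambda>u. f u + g u, \<lambda>u. f' u + g' u) \<in> jet_rel r"
  by (simp add: mem_jet_rel_iff smooth_add mderiv_add)

lemma jet_rel_cmult: "(f, g) \<in> jet_rel r \<Longrightarrow> (\<lambda>u. c * f u, \<lambda>u. c * g u) \<in> jet_rel r"
  by (simp add: mem_jet_rel_iff smooth_cmult mderiv_cmult)

text \<open>Reduces congruences to null jets, where \<open>mderiv_mult_vanishing\<close> applies.
  The difference is written with \<open>- 1 * g\<close> so that the laws for sums and scalar
  multiples suffice.\<close>

lemma jet_rel_diff_iff:
  assumes "smooth f" "smooth g"
  shows "(f, g) \<in> jet_rel r \<longleftrightarrow> (\<lambda>u. f u + - 1 * g u, \<lambda>u. 0) \<in> jet_rel r"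
proof -
  have "mderiv M (\<lambda>u. f u + - 1 * g u) = (\<lambda>u. mderiv M f u + - 1 * mderiv M g u)" for M
    using assms mderiv_add[OF assms(1) smooth_cmult[OF assms(2)], of M "- 1"] mderiv_cmult[OF assms(2), of M "- 1"]
    by simp
  moreover have "smooth (\<lambda>u. f u + - 1 * g u)"
    using assms by (intro smooth_add smooth_cmult)
  ultimately show ?thesis
    using assms by (simp add: mem_jet_rel_iff mderiv_const)
qed

lemma jet_rel_mult_null:
  assumes "smooth h" "(b, \<lambda>u. 0) \<in> jet_rel r"
  shows "(\<lambda>u. h u * b u, \<lambda>u. 0) \<in> jet_rel r"
proof -
  have b: "smooth b" "\<And>N. size N \<le> r \<Longrightarrow> mderiv N b 0 = 0"
    using assms(2) by (auto simp: mem_jet_rel_iff mderiv_const)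
  have "mderiv M (\<lambda>u. h u * b u) 0 = 0" if "size M \<le> r" for M
    using that b assms(1) by (subst mderiv_mult_vanishing) auto
  then show ?thesis
    using b assms(1) by (auto simp: mem_jet_rel_iff mderiv_const)
qed

lemma jet_rel_mult_left:
  assumes "smooth h" "(f, g) \<in> jet_rel r"
  shows "(\<lambda>u. h u * f u, \<lambda>u. h u * g u) \<in> jet_rel r"
proof -
  note sm = jet_rel_smooth[OF assms(2)]
  have "(\<lambda>u. h u * (f u + - 1 * g u), \<lambda>u. 0) \<in> jet_rel r"
    by (rule jet_rel_mult_null[OF assms(1) iffD1[OF jet_rel_diff_iff[OF sm] assms(2)]])
  moreover have "(\<lambda>u. h u * (f u + - 1 * g u)) = (\<lambda>u. h u * f u + - 1 * (h u * g u))"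
    by (simp add: algebra_simps)
  moreover have "smooth (\<lambda>u. h u * f u)" "smooth (\<lambda>u. h u * g u)"
    using assms(1) sm by (simp_all add: smooth_mult)
  ultimately show ?thesis
    by (simp only: jet_rel_diff_iff)
qed

lemma jet_rel_mult:
  assumes "(f, f') \<in> jet_rel r" "(g, g') \<in> jet_rel r"
  shows "(\<lambda>u. f u * g u, \<lambda>u. f' u * g' u) \<in> jet_rel r"
proof -
  have "(\<lambda>u. f u * g u, \<lambda>u. f u * g' u) \<in> jet_rel r"
    using assms by (intro jet_rel_mult_left) (auto dest: jet_rel_smooth)
  moreover have "(\<lambda>u. g' u * f u, \<lambda>u. g' u * f' u) \<in> jet_rel r"
    using assms by (intro jet_rel_mult_left) (auto dest: jet_rel_smooth)
  moreover have "(\<lambda>u. g' u * f u) = (\<lambda>u. f u * g' u)" "(\<lambda>u. g' u * f' u) = (\<lambda>u. f' u * g' u)"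
    by (simp_all add: mult.commute)
  ultimately show ?thesis
    by (simp add: mem_jet_rel_iff)
qed

section \<open>Jets as classes of smooth functions\<close>

definition jet_of :: "nat \<Rightarrow> (real ^ 'k::finite \<Rightarrow> real) \<Rightarrow> 'k jet"
  where "jet_of r f = jet_rel r `` {f}"

lemma jet_of_eq_iff: "smooth f \<Longrightarrow> smooth g \<Longrightarrow> jet_of r f = jet_of r g \<longleftrightarrow> (f, g) \<in> jet_rel r"
  unfolding jet_of_def by (rule eq_equiv_class_iff[OF equiv_jet_rel]) simp_all

lemma jet_of_eqI: "(f, g) \<in> jet_rel r \<Longrightarrow> jet_of r f = jet_of r g"
  unfolding jet_of_def by (rule equiv_class_eq[OF equiv_jet_rel])

lemma jet_of_carrier: "smooth f \<Longrightarrow> jet_of r f \<in> carrier (jet_algebra r)"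
  by (simp add: jet_of_def jet_algebra_def quotientI)

lemma carrier_jetE:
  assumes "x \<in> carrier (jet_algebra r)"
  obtains f where "smooth f" "x = jet_of r f"
  using assms that by (auto simp: jet_of_def jet_algebra_def quotient_def)

lemma jet_of_mult:
  assumes "smooth f" "smooth g"
  shows "jet_of r f \<otimes>\<^bsub>jet_algebra r\<^esub> jet_of r g = jet_of r (\<lambda>u. f u * g u)"
proof -
  have "congruent2 (jet_rel r) (jet_rel r) (\<lambda>f g. jet_of r (\<lambda>u. f u * g u))"
    by (clarsimp simp: congruent2_def) (intro jet_of_eqI jet_rel_mult; assumption)
  from UN_equiv_class2[OF equiv_jet_rel equiv_jet_rel this] assms show ?thesis
    by (simp add: jet_algebra_def jet_of_def)
qed

lemma jet_of_add:
  assumes "smooth f" "smooth g"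
  shows "jet_of r f \<oplus>\<^bsub>jet_algebra r\<^esub> jet_of r g = jet_of r (\<lambda>u. f u + g u)"
proof -
  have "congruent2 (jet_rel r) (jet_rel r) (\<lambda>f g. jet_of r (\<lambda>u. f u + g u))"
    by (clarsimp simp: congruent2_def) (intro jet_of_eqI jet_rel_add; assumption)
  from UN_equiv_class2[OF equiv_jet_rel equiv_jet_rel this] assms show ?thesis
    by (simp add: jet_algebra_def jet_of_def)
qed

lemma jet_of_smult:
  assumes "smooth f"
  shows "c \<odot>\<^bsub>jet_algebra r\<^esub> jet_of r f = jet_of r (\<lambda>u. c * f u)"
proof -
  have "congruent (jet_rel r) (\<lambda>f. jet_of r (\<lambda>u. c * f u))"
    by (clarsimp simp: congruent_def) (intro jet_of_eqI jet_rel_cmult; assumption)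
  from UN_equiv_class[OF equiv_jet_rel this] assms show ?thesis
    by (simp add: jet_algebra_def jet_of_def)
qed

definition smooth_lists :: "nat \<Rightarrow> (real ^ 'k::finite \<Rightarrow> real) list set"
  where "smooth_lists s = {fs. length fs = s \<and> (\<forall>f\<in>set fs. smooth f)}"

lemma smooth_lists_length: "fs \<in> smooth_lists s \<Longrightarrow> length fs = s"
  by (simp add: smooth_lists_def)

lemma smooth_lists_nth: "fs \<in> smooth_lists s \<Longrightarrow> t < s \<Longrightarrow> smooth (fs ! t)"
  by (simp add: smooth_lists_def)

lemma smooth_lists_update: "fs \<in> smooth_lists s \<Longrightarrow> smooth b \<Longrightarrow> fs[t := b] \<in> smooth_lists s"
  using set_update_subset_insert[of fs t b] by (auto simp: smooth_lists_def)

lemma tuples_jet: "a \<in> tuples (jet_algebra r) s \<longleftrightarrow> (\<exists>fs\<in>smooth_lists s. a = map (jet_of r) fs)"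
proof
  show "a \<in> tuples (jet_algebra r) s \<Longrightarrow> \<exists>fs\<in>smooth_lists s. a = map (jet_of r) fs"
  proof (induction a arbitrary: s)
    case Nil
    then show ?case by (auto simp: tuples_def smooth_lists_def)
  next
    case (Cons x a)
    then have "x \<in> carrier (jet_algebra r)" and a: "a \<in> tuples (jet_algebra r) (s - 1)" and s: "s = Suc (s - 1)"
      by (auto simp: tuples_def)
    then obtain f fs where "smooth f" "x = jet_of r f" "fs \<in> smooth_lists (s - 1)" "a = map (jet_of r) fs"
      using Cons.IH[OF a] by (elim carrier_jetE bexE)
    then show ?case
      using s by (intro bexI[where x = "f # fs"]) (auto simp: smooth_lists_def)
  qed
qed (auto simp: tuples_def smooth_lists_def jet_of_carrier)

text \<open>Elements of \<open>A\<^sub>s\<close>, read as functionals of representatives of jets.\<close>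

locale jet_form =
  fixes r s :: nat and H :: "(real ^ 'k::finite \<Rightarrow> real) list \<Rightarrow> (real ^ 'k \<Rightarrow> real) \<Rightarrow> real"
  assumes slot_add: "\<lbrakk>fs \<in> smooth_lists s; t < s; smooth b; smooth c; smooth g\<rbrakk>
      \<Longrightarrow> H (fs[t := \<lambda>u. b u + c u]) g = H (fs[t := b]) g + H (fs[t := c]) g"
    and slot_cmult: "\<lbrakk>fs \<in> smooth_lists s; t < s; smooth b; smooth g\<rbrakk>
      \<Longrightarrow> H (fs[t := \<lambda>u. k * b u]) g = k * H (fs[t := b]) g"
    and slot_cong: "\<lbrakk>fs \<in> smooth_lists s; t < s; (b, c) \<in> jet_rel r; smooth g\<rbrakk>
      \<Longrightarrow> H (fs[t := b]) g = H (fs[t := c]) g"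
    and skew: "\<lbrakk>fs \<in> smooth_lists s; i < s; j < s; i \<noteq> j; smooth g\<rbrakk>
      \<Longrightarrow> H (fs[i := fs ! j, j := fs ! i]) g = - H fs g"
    and leibniz: "\<lbrakk>fs \<in> smooth_lists s; t < s; smooth b; smooth c; smooth g\<rbrakk>
      \<Longrightarrow> H (fs[t := \<lambda>u. b u * c u]) g = H (fs[t := b]) (\<lambda>u. c u * g u) + H (fs[t := c]) (\<lambda>u. b u * g u)"
    and value_add: "\<lbrakk>fs \<in> smooth_lists s; smooth g; smooth h\<rbrakk> \<Longrightarrow> H fs (\<lambda>u. g u + h u) = H fs g + H fs h"
    and value_cmult: "\<lbrakk>fs \<in> smooth_lists s; smooth g\<rbrakk> \<Longrightarrow> H fs (\<lambda>u. k * g u) = k * H fs g"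
    and value_cong: "\<lbrakk>fs \<in> smooth_lists s; (g, h) \<in> jet_rel r\<rbrakk> \<Longrightarrow> H fs g = H fs h"

lemma jet_form_of_skew_derivation:
  fixes F :: "'k::finite jet list \<Rightarrow> 'k jet \<Rightarrow> real"
  assumes "F \<in> skew_derivations (jet_algebra r) s"
  shows "jet_form r s (\<lambda>fs g. F (map (jet_of r) fs) (jet_of r g))"
proof -
  let ?A = "jet_algebra r :: (real, 'k jet) module"
  have dual: "\<And>a. a \<in> tuples ?A s \<Longrightarrow> F a \<in> dual ?A" and multi: "multilinear ?A s F"
    and skew: "skew_symmetric ?A s F" and deriv: "derivation_identity ?A s F"
    using assms by (simp_all add: skew_derivations_def)
  have tup: "map (jet_of r) fs \<in> tuples ?A s" if "fs \<in> smooth_lists s" for fs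
    using that tuples_jet by blast
  show ?thesis
  proof
    fix fs :: "(real ^ 'k \<Rightarrow> real) list" and b c g :: "real ^ 'k \<Rightarrow> real" and t
    assume "fs \<in> smooth_lists s" "t < s" "smooth b" "smooth c" "smooth g"
    note * = tup[OF \<open>fs \<in> smooth_lists s\<close>] \<open>t < s\<close> jet_of_carrier[OF \<open>smooth b\<close>] jet_of_carrier[OF \<open>smooth c\<close>]
      jet_of_carrier[OF \<open>smooth g\<close>]
    from * have "F ((map (jet_of r) fs)[t := jet_of r b \<oplus>\<^bsub>?A\<^esub> jet_of r c])
        = F ((map (jet_of r) fs)[t := jet_of r b]) + F ((map (jet_of r) fs)[t := jet_of r c])"
      using multi unfolding multilinear_def by simp
    then show "F (map (jet_of r) (fs[t := \<lambda>u. b u + c u])) (jet_of r g)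
        = F (map (jet_of r) (fs[t := b])) (jet_of r g) + F (map (jet_of r) (fs[t := c])) (jet_of r g)"
      using \<open>smooth b\<close> \<open>smooth c\<close> by (simp add: jet_of_add map_update)
  next
    fix fs :: "(real ^ 'k \<Rightarrow> real) list" and b g :: "real ^ 'k \<Rightarrow> real" and t k
    assume "fs \<in> smooth_lists s" "t < s" "smooth b" "smooth g"
    note * = tup[OF \<open>fs \<in> smooth_lists s\<close>] \<open>t < s\<close> jet_of_carrier[OF \<open>smooth b\<close>]
    from * have "F ((map (jet_of r) fs)[t := k \<odot>\<^bsub>?A\<^esub> jet_of r b])
        = (\<lambda>d. k * F ((map (jet_of r) fs)[t := jet_of r b]) d)"
      using multi unfolding multilinear_def by simp
    then show "F (map (jet_of r) (fs[t := \<lambda>u. k * b u])) (jet_of r g)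
        = k * F (map (jet_of r) (fs[t := b])) (jet_of r g)"
      using \<open>smooth b\<close> by (simp add: jet_of_smult map_update)
  next
    fix fs :: "(real ^ 'k \<Rightarrow> real) list" and b c g :: "real ^ 'k \<Rightarrow> real" and t
    assume bc: "(b, c) \<in> jet_rel r"
    show "F (map (jet_of r) (fs[t := b])) (jet_of r g) = F (map (jet_of r) (fs[t := c])) (jet_of r g)"
      by (simp add: map_update jet_of_eqI[OF bc])
  next
    fix fs :: "(real ^ 'k \<Rightarrow> real) list" and g :: "real ^ 'k \<Rightarrow> real" and i j
    assume *: "fs \<in> smooth_lists s" "i < s" "j < s" "i \<noteq> j"
    let ?a = "map (jet_of r) fs"
    have "F (?a[i := ?a ! j, j := ?a ! i]) = - F ?a"
      using bspec[OF skew[unfolded skew_symmetric_def] tup[OF *(1)]] *(2-) by blast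
    then show "F (map (jet_of r) (fs[i := fs ! j, j := fs ! i])) (jet_of r g) = - F ?a (jet_of r g)"
      using * by (simp add: map_update smooth_lists_length)
  next
    fix fs :: "(real ^ 'k \<Rightarrow> real) list" and b c g :: "real ^ 'k \<Rightarrow> real" and t
    assume "fs \<in> smooth_lists s" "t < s" "smooth b" "smooth c" "smooth g"
    note * = tup[OF \<open>fs \<in> smooth_lists s\<close>] \<open>t < s\<close> jet_of_carrier[OF \<open>smooth b\<close>] jet_of_carrier[OF \<open>smooth c\<close>]
      jet_of_carrier[OF \<open>smooth g\<close>]
    from * have "F ((map (jet_of r) fs)[t := jet_of r b \<otimes>\<^bsub>?A\<^esub> jet_of r c]) (jet_of r g)
        = F ((map (jet_of r) fs)[t := jet_of r b]) (jet_of r c \<otimes>\<^bsub>?A\<^esub> jet_of r g)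
        + F ((map (jet_of r) fs)[t := jet_of r c]) (jet_of r b \<otimes>\<^bsub>?A\<^esub> jet_of r g)"
      using deriv unfolding derivation_identity_def by simp
    then show "F (map (jet_of r) (fs[t := \<lambda>u. b u * c u])) (jet_of r g)
        = F (map (jet_of r) (fs[t := b])) (jet_of r (\<lambda>u. c u * g u))
        + F (map (jet_of r) (fs[t := c])) (jet_of r (\<lambda>u. b u * g u))"
      using \<open>smooth b\<close> \<open>smooth c\<close> \<open>smooth g\<close> by (simp add: jet_of_mult map_update)
  next
    fix fs :: "(real ^ 'k \<Rightarrow> real) list" and g h :: "real ^ 'k \<Rightarrow> real"
    assume "fs \<in> smooth_lists s" "smooth g" "smooth h"
    then have "F (map (jet_of r) fs) (jet_of r g \<oplus>\<^bsub>?A\<^esub> jet_of r h)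
        = F (map (jet_of r) fs) (jet_of r g) + F (map (jet_of r) fs) (jet_of r h)"
      using dual[OF tup] by (simp add: dual_def jet_of_carrier)
    then show "F (map (jet_of r) fs) (jet_of r (\<lambda>u. g u + h u))
        = F (map (jet_of r) fs) (jet_of r g) + F (map (jet_of r) fs) (jet_of r h)"
      using \<open>smooth g\<close> \<open>smooth h\<close> by (simp add: jet_of_add)
  next
    fix fs :: "(real ^ 'k \<Rightarrow> real) list" and g :: "real ^ 'k \<Rightarrow> real" and k
    assume "fs \<in> smooth_lists s" "smooth g"
    then have "F (map (jet_of r) fs) (k \<odot>\<^bsub>?A\<^esub> jet_of r g) = k * F (map (jet_of r) fs) (jet_of r g)"
      using dual[OF tup] by (simp add: dual_def jet_of_carrier)
    then show "F (map (jet_of r) fs) (jet_of r (\<lambda>u. k * g u)) = k * F (map (jet_of r) fs) (jet_of r g)"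
      using \<open>smooth g\<close> by (simp add: jet_of_smult)
  next
    fix fs :: "(real ^ 'k \<Rightarrow> real) list" and g h :: "real ^ 'k \<Rightarrow> real"
    assume gh: "(g, h) \<in> jet_rel r"
    show "F (map (jet_of r) fs) (jet_of r g) = F (map (jet_of r) fs) (jet_of r h)"
      by (simp add: jet_of_eqI[OF gh])
  qed
qed

text \<open>Outside tuples and carriers \<open>F\<close> is \<open>0\<close> by the convention on
  restricted domains; inside, every argument has a smooth representative.\<close>

lemma skew_derivation_eq_0:
  assumes "F \<in> skew_derivations (jet_algebra r) s"
    and "\<And>fs g. fs \<in> smooth_lists s \<Longrightarrow> smooth g \<Longrightarrow> F (map (jet_of r) fs) (jet_of r g) = 0"
  shows "F = 0"
proof (intro ext)
  fix a x
  show "F a x = 0 a x"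
  proof (cases "a \<in> tuples (jet_algebra r) s \<and> x \<in> carrier (jet_algebra r)")
    case True
    then obtain fs g where "fs \<in> smooth_lists s" "a = map (jet_of r) fs" "smooth g" "x = jet_of r g"
      unfolding tuples_jet by (elim conjE carrier_jetE bexE)
    then show ?thesis by (simp add: assms(2))
  next
    case False
    then show ?thesis
      using assms(1) by (auto simp: skew_derivations_def dual_def)
  qed
qed

section \<open>From functionals of representatives back to jets\<close>

context jet_form
begin

text \<open>Entries are replaced one at a time from the left, each time by
  \<open>slot_cong\<close>.\<close>

lemma lists_cong:
  assumes "fs \<in> smooth_lists s" "gs \<in> smooth_lists s" "smooth g"
    and rel: "\<And>t. t < s \<Longrightarrow> (fs ! t, gs ! t) \<in> jet_rel r"
  shows "H fs g = H gs g"
proof -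
  have "H (take n gs @ drop n fs) g = H fs g" if "n \<le> s" for n
    using that
  proof (induction n)
    case (Suc n)
    let ?l = "take n gs @ drop n fs"
    have len: "length fs = s" "length gs = s"
      using assms by (simp_all add: smooth_lists_length)
    have l: "?l \<in> smooth_lists s"
      using assms(1,2) Suc.prems by (auto simp: smooth_lists_def dest: in_set_takeD in_set_dropD)
    have "take (Suc n) gs @ drop (Suc n) fs = ?l[n := gs ! n]" "?l[n := fs ! n] = ?l"
      using Suc.prems len
      by (auto simp: take_Suc_conv_app_nth list_update_append Cons_nth_drop_Suc[symmetric])
    then show ?case
      using slot_cong[OF l _ rel assms(3), of n n] Suc by simp
  qed simp
  from this[of s] show ?thesis
    using assms by (simp add: smooth_lists_length)
qed

text \<open>The way back from \<open>jet_form_of_skew_derivation\<close>. The choice of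
  representatives is harmless by \<open>lists_cong\<close> and \<open>value_cong\<close>.\<close>

definition lift :: "'k jet list \<Rightarrow> 'k jet \<Rightarrow> real"
  where "lift a x = (if a \<in> tuples (jet_algebra r) s \<and> x \<in> carrier (jet_algebra r)
    then H (map (\<lambda>y. SOME f. smooth f \<and> y = jet_of r f) a) (SOME g. smooth g \<and> x = jet_of r g) else 0)"

lemma lift_jet_of:
  assumes fs: "fs \<in> smooth_lists s" and g: "smooth g"
  shows "lift (map (jet_of r) fs) (jet_of r g) = H fs g"
proof -
  have some: "smooth (SOME h. smooth h \<and> jet_of r f = jet_of r h) \<and>
      jet_of r f = jet_of r (SOME h. smooth h \<and> jet_of r f = jet_of r h)" if "smooth f" for f :: "real ^ 'k \<Rightarrow> real"
    using that by (intro someI[where P = "\<lambda>h. smooth h \<and> jet_of r f = jet_of r h"]) simp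
  let ?fs = "map (\<lambda>y. SOME f. smooth f \<and> y = jet_of r f) (map (jet_of r) fs)"
    and ?g = "SOME h. smooth h \<and> jet_of r g = jet_of r h"
  have fs': "?fs \<in> smooth_lists s"
    using fs some by (auto simp: smooth_lists_def)
  have "(?fs ! t, fs ! t) \<in> jet_rel r" if "t < s" for t
    using some[OF smooth_lists_nth[OF fs that]] that smooth_lists_nth[OF fs that] fs
    by (simp add: smooth_lists_length flip: jet_of_eq_iff)
  then have "H ?fs ?g = H fs ?g"
    using fs fs' some[OF g] by (intro lists_cong) auto
  also have "\<dots> = H fs g"
    using some[OF g] g by (intro value_cong fs) (simp flip: jet_of_eq_iff)
  finally show ?thesis
    using fs g by (auto simp: lift_def tuples_jet jet_of_carrier)
qed

lemma lift_skew_derivation: "lift \<in> skew_derivations (jet_algebra r) s"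
proof -
  let ?A = "jet_algebra r :: (real, 'k jet) module"
  have upd: "lift ((map (jet_of r) fs)[t := jet_of r b]) (jet_of r g) = H (fs[t := b]) g"
    if "fs \<in> smooth_lists s" "smooth b" "smooth g" for fs t b g
    using lift_jet_of[of "fs[t := b]" g] that by (simp add: smooth_lists_update map_update)
  have outside: "lift a x = 0" if "x \<notin> carrier ?A" for a x
    using that by (simp add: lift_def)
  have "lift a \<in> dual ?A" if a: "a \<in> tuples ?A s" for a
  proof -
    obtain fs where fs: "fs \<in> smooth_lists s" "a = map (jet_of r) fs"
      using a by (auto simp: tuples_jet)
    show ?thesis
      unfolding dual_def fs(2)
    proof (intro CollectI conjI ballI allI impI)
      fix x y assume "x \<in> carrier ?A" "y \<in> carrier ?A"
      then show "lift (map (jet_of r) fs) (x \<oplus>\<^bsub>?A\<^esub> y)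
          = lift (map (jet_of r) fs) x + lift (map (jet_of r) fs) y"
        using fs(1) by (elim carrier_jetE) (simp add: jet_of_add lift_jet_of smooth_add value_add)
    next
      fix c x assume "x \<in> carrier ?A"
      then show "lift (map (jet_of r) fs) (c \<odot>\<^bsub>?A\<^esub> x) = c * lift (map (jet_of r) fs) x"
        using fs(1) by (elim carrier_jetE) (simp add: jet_of_smult lift_jet_of smooth_cmult value_cmult)
    qed (rule outside)
  qed
  moreover have "multilinear ?A s lift"
    unfolding multilinear_def
  proof (intro ballI allI impI conjI)
    fix a t b c assume "a \<in> tuples ?A s" "t < s" "b \<in> carrier ?A" "c \<in> carrier ?A"
    then obtain fs b' c' where *: "fs \<in> smooth_lists s" "a = map (jet_of r) fs" "smooth b'" "b = jet_of r b'"
      "smooth c'" "c = jet_of r c'"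
      unfolding tuples_jet by (elim carrier_jetE bexE)
    show "lift (a[t := b \<oplus>\<^bsub>?A\<^esub> c]) = lift (a[t := b]) + lift (a[t := c])"
    proof
      fix d
      show "lift (a[t := b \<oplus>\<^bsub>?A\<^esub> c]) d = (lift (a[t := b]) + lift (a[t := c])) d"
      proof (cases "d \<in> carrier ?A")
        case True
        then show ?thesis
          using * \<open>t < s\<close> by (elim carrier_jetE) (simp add: jet_of_add upd smooth_add slot_add)
      qed (simp add: outside)
    qed
  next
    fix a t k b assume "a \<in> tuples ?A s" "t < s" "b \<in> carrier ?A"
    then obtain fs b' where *: "fs \<in> smooth_lists s" "a = map (jet_of r) fs" "smooth b'" "b = jet_of r b'"
      unfolding tuples_jet by (elim carrier_jetE bexE)
    show "lift (a[t := k \<odot>\<^bsub>?A\<^esub> b]) = (\<lambda>d. k * lift (a[t := b]) d)"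
    proof
      fix d
      show "lift (a[t := k \<odot>\<^bsub>?A\<^esub> b]) d = k * lift (a[t := b]) d"
      proof (cases "d \<in> carrier ?A")
        case True
        then show ?thesis
          using * \<open>t < s\<close> by (elim carrier_jetE) (simp add: jet_of_smult upd smooth_cmult slot_cmult)
      qed (simp add: outside)
    qed
  qed
  moreover have "skew_symmetric ?A s lift"
    unfolding skew_symmetric_def
  proof (intro ballI allI impI)
    fix a i j assume "a \<in> tuples ?A s" and ij: "i < s" "j < s" "i \<noteq> j"
    then obtain fs where fs: "fs \<in> smooth_lists s" "a = map (jet_of r) fs"
      by (auto simp: tuples_jet)
    then have fs': "fs[i := fs ! j, j := fs ! i] \<in> smooth_lists s"
      using ij by (intro smooth_lists_update smooth_lists_nth)
    have a': "a[i := a ! j, j := a ! i] = map (jet_of r) (fs[i := fs ! j, j := fs ! i])"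
      using fs ij by (simp add: map_update smooth_lists_length)
    show "lift (a[i := a ! j, j := a ! i]) = - lift a"
    proof
      fix d
      show "lift (a[i := a ! j, j := a ! i]) d = (- lift a) d"
      proof (cases "d \<in> carrier ?A")
        case True
        then show ?thesis
          unfolding a' using fs fs' ij by (elim carrier_jetE) (simp add: lift_jet_of skew)
      qed (simp add: outside)
    qed
  qed
  moreover have "derivation_identity ?A s lift"
    unfolding derivation_identity_def
  proof (intro ballI allI impI)
    fix a t b c d assume "a \<in> tuples ?A s" "t < s" "b \<in> carrier ?A" "c \<in> carrier ?A" "d \<in> carrier ?A"
    then obtain fs b' c' d' where *: "fs \<in> smooth_lists s" "a = map (jet_of r) fs" "smooth b'" "b = jet_of r b'"
      "smooth c'" "c = jet_of r c'" "smooth d'" "d = jet_of r d'"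
      unfolding tuples_jet by (elim carrier_jetE bexE)
    then show "lift (a[t := b \<otimes>\<^bsub>?A\<^esub> c]) d
        = lift (a[t := b]) (c \<otimes>\<^bsub>?A\<^esub> d) + lift (a[t := c]) (b \<otimes>\<^bsub>?A\<^esub> d)"
      using \<open>t < s\<close> by (simp add: jet_of_mult upd smooth_mult leibniz)
  qed
  moreover have "lift a = 0" if "a \<notin> tuples ?A s" for a
    using that by (simp add: lift_def fun_eq_iff)
  ultimately show ?thesis
    by (simp add: skew_derivations_def)
qed

end

section \<open>Forms given by coefficient families\<close>

definition deriv_prod :: "'k::finite list \<Rightarrow> (real ^ 'k \<Rightarrow> real) list \<Rightarrow> real ^ 'k \<Rightarrow> real"
  where "deriv_prod I fs u = (\<Prod>p<length I. partial_deriv (I ! p) (fs ! p) u)"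

definition deriv_prod_except :: "nat \<Rightarrow> 'k::finite list \<Rightarrow> (real ^ 'k \<Rightarrow> real) list \<Rightarrow> real ^ 'k \<Rightarrow> real"
  where "deriv_prod_except t I fs u = (\<Prod>p\<in>{..<length I} - {t}. partial_deriv (I ! p) (fs ! p) u)"

lemma smooth_deriv_prod:
  assumes "fs \<in> smooth_lists s" "length I = s"
  shows "smooth (deriv_prod I fs)"
  unfolding deriv_prod_def
  by (rule smooth_prod) (use assms in \<open>auto intro: smooth_partial_deriv smooth_lists_nth\<close>)

lemma smooth_deriv_prod_except:
  assumes "fs \<in> smooth_lists s" "length I = s"
  shows "smooth (deriv_prod_except t I fs)"
  unfolding deriv_prod_except_def
  by (rule smooth_prod) (use assms in \<open>auto intro: smooth_partial_deriv smooth_lists_nth\<close>)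

lemma deriv_prod_update:
  assumes "t < length I" "length fs = length I"
  shows "deriv_prod I (fs[t := b]) u = partial_deriv (I ! t) b u * deriv_prod_except t I fs u"
proof -
  have "deriv_prod I (fs[t := b]) u
      = partial_deriv (I ! t) (fs[t := b] ! t) u * (\<Prod>p\<in>{..<length I} - {t}. partial_deriv (I ! p) (fs[t := b] ! p) u)"
    unfolding deriv_prod_def by (rule prod.remove) (use assms in auto)
  also have "(\<Prod>p\<in>{..<length I} - {t}. partial_deriv (I ! p) (fs[t := b] ! p) u) = deriv_prod_except t I fs u"
    unfolding deriv_prod_except_def by (intro prod.cong) auto
  finally show ?thesis using assms by simp
qed

lemma deriv_prod_except_update: "deriv_prod_except t (J[t := i]) fs u = deriv_prod_except t J fs u"
  unfolding deriv_prod_except_def by (intro prod.cong) auto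

text \<open>Reindexing the product moves the transposition from the functions to the indices; this
  turns skew-symmetry of the coefficients into skew-symmetry of the form.\<close>

lemma deriv_prod_swap:
  assumes "length fs = length I" "i < length I" "j < length I"
  shows "deriv_prod I (fs[i := fs ! j, j := fs ! i]) = deriv_prod (I[i := I ! j, j := I ! i]) fs"
proof
  fix u
  let ?t = "Transposition.transpose i j"
  have t: "?t permutes {..<length I}" using assms by (simp add: permutes_swap_id)
  have "deriv_prod I (permute_list ?t fs) u = (\<Prod>p<length I. partial_deriv (I ! p) (fs ! ?t p) u)"
    unfolding deriv_prod_def using assms t by (intro prod.cong) (simp_all add: permute_list_nth)
  also have "\<dots> = (\<Prod>p<length I. partial_deriv (I ! ?t p) (fs ! p) u)"
    using prod.permute[OF t, of "\<lambda>p. partial_deriv (I ! p) (fs ! ?t p) u"] by simp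
  also have "\<dots> = deriv_prod (permute_list ?t I) fs u"
    unfolding deriv_prod_def using assms t by (intro prod.cong) (simp_all add: permute_list_nth)
  finally show "deriv_prod I (fs[i := fs ! j, j := fs ! i]) u = deriv_prod (I[i := I ! j, j := I ! i]) fs u"
    using assms by (simp add: swap_eq_permute_list)
qed

abbreviation coord :: "'k \<Rightarrow> real ^ 'k \<Rightarrow> real"
  where "coord j \<equiv> (\<lambda>u. u $ j)"

lemma coords_smooth_lists: "length L = s \<Longrightarrow> map coord L \<in> smooth_lists s"
  by (auto simp: smooth_lists_def)

lemma deriv_prod_coords:
  assumes "length L = length I"
  shows "deriv_prod I (map coord L) = (\<lambda>u. if I = L then 1 else 0)"
proof
  fix u
  have "deriv_prod I (map coord L) u = (\<Prod>p<length I. if I ! p = L ! p then 1 else 0)"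
    unfolding deriv_prod_def using assms by (intro prod.cong) simp_all
  also have "\<dots> = (if I = L then 1 else 0)"
  proof (cases "I = L")
    case False
    then obtain p where "p < length I" "I ! p \<noteq> L ! p"
      using assms by (auto simp: list_eq_iff_nth_eq)
    then have "(\<Prod>p<length I. if I ! p = L ! p then 1 else (0::real)) = 0"
      by (intro prod_zero) auto
    with False show ?thesis by simp
  qed simp
  finally show "deriv_prod I (map coord L) u = (if I = L then 1 else 0)" .
qed

text \<open>For \<open>size M \<le> r\<close>, \<open>C I M\<close> stands for F(x^I)(x^M) / M!. In
  the relation coming from x^\<beta> = 0 the term of index i carries the factor \<beta>_i, and
  \<beta>_i (\<beta> - i)! = \<beta>!, so after this normalisation every index in the support of
  \<beta> is summed just once.\<close>

locale coeff_family =
  fixes r s :: nat and C :: "'k::finite list \<Rightarrow> 'k multiset \<Rightarrow> real"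
  assumes C_skew: "\<lbrakk>length I = s; i < s; j < s; i \<noteq> j\<rbrakk> \<Longrightarrow> C (I[i := I ! j, j := I ! i]) M = - C I M"
    and C_cocycle: "\<lbrakk>length J = s; t < s; size \<beta> = Suc r\<rbrakk>
      \<Longrightarrow> (\<Sum>i\<in>set_mset \<beta>. C (J[t := i]) (\<beta> - {#i#})) = 0"
begin

text \<open>A functional supported at \<open>0\<close>, applied to the form g df_1 ... df_s. Since
  \<open>g\<close> stands inside the derivative, the derivation identity is an instance of the
  product rule.\<close>

definition coeff_form :: "(real ^ 'k \<Rightarrow> real) list \<Rightarrow> (real ^ 'k \<Rightarrow> real) \<Rightarrow> real"
  where "coeff_form fs g
    = (\<Sum>I | length I = s. \<Sum>M | size M \<le> r. C I M * mderiv M (\<lambda>u. g u * deriv_prod I fs u) 0)"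

lemma coeff_form_update:
  assumes "fs \<in> smooth_lists s" "t < s"
  shows "coeff_form (fs[t := b]) g = (\<Sum>I | length I = s. \<Sum>M | size M \<le> r.
    C I M * mderiv M (\<lambda>u. g u * (partial_deriv (I ! t) b u * deriv_prod_except t I fs u)) 0)"
  unfolding coeff_form_def
  using assms by (intro sum.cong refl) (simp add: deriv_prod_update smooth_lists_length)

text \<open>The one place where \<open>C_cocycle\<close> enters: it makes the form independent of
  the representatives in the slots.\<close>

lemma coeff_form_null:
  assumes fs: "fs \<in> smooth_lists s" and t: "t < s" and g: "smooth g" and b: "(b, \<lambda>u. 0) \<in> jet_rel r"
  shows "coeff_form (fs[t := b]) g = 0"
proof -
  let ?E = "\<lambda>I. deriv_prod_except t I fs"
  have sb: "smooth b" and b0: "\<And>N. size N \<le> r \<Longrightarrow> mderiv N b 0 = 0"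
    using b by (auto simp: mem_jet_rel_iff mderiv_const)
  \<comment> \<open>Derivatives of \<open>partial_deriv i b\<close> of order below \<open>r\<close>
    vanish at \<open>0\<close>, so only the term in which all of \<open>M\<close> falls on this
    factor can remain.\<close>
  have mderiv_term: "mderiv M (\<lambda>u. g u * (partial_deriv i b u * ?E I u)) 0
      = g 0 * ?E I 0 * mderiv (add_mset i M) b 0" if "size M \<le> r" "length I = s" for M i I
  proof -
    have "mderiv M (\<lambda>u. (g u * ?E I u) * partial_deriv i b u) 0 = (g 0 * ?E I 0) * mderiv M (partial_deriv i b) 0"
    proof (rule mderiv_mult_vanishing)
      show "smooth (\<lambda>u. g u * ?E I u)"
        using g smooth_deriv_prod_except[OF fs that(2)] by (rule smooth_mult)
      show "smooth (partial_deriv i b)"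
        by (rule smooth_partial_deriv[OF sb])
      show "mderiv N (partial_deriv i b) 0 = 0" if "size N < size M" for N
        using b0[of "add_mset i N"] that \<open>size M \<le> r\<close> by (simp add: mderiv_add_mset sb)
    qed
    then show ?thesis
      by (simp add: mderiv_add_mset sb ac_simps)
  qed
  have inner: "(\<Sum>i\<in>UNIV. \<Sum>M | size M \<le> r. C (J[t := i]) M * mderiv (add_mset i M) b 0) = 0"
    if J: "length J = s" for J
  proof -
    have fin: "finite {M :: 'k multiset. size M = n}" for n
      using finite_multisets_size[of "UNIV :: 'k set" n] by simp
    \<comment> \<open>For \<open>size M < r\<close> the derivative of \<open>b\<close> has order at
      most \<open>r\<close> and vanishes. The rest is regrouped by \<beta> = M + i, which exposes
      the cocycle sum as a factor.\<close>
    have "(\<Sum>i\<in>UNIV. \<Sum>M | size M \<le> r. C (J[t := i]) M * mderiv (add_mset i M) b 0)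
        = (\<Sum>i\<in>UNIV. \<Sum>M | size M = r. C (J[t := i]) M * mderiv (add_mset i M) b 0)"
      by (intro sum.cong refl sum.mono_neutral_right) (auto simp: finite_multisets_size_le b0)
    also have "\<dots> = (\<Sum>(i, M)\<in>UNIV \<times> {M. size M = r}. C (J[t := i]) M * mderiv (add_mset i M) b 0)"
      by (rule sum.cartesian_product)
    also have "\<dots> = (\<Sum>(\<beta>, i)\<in>Sigma {\<beta>. size \<beta> = Suc r} set_mset.
        C (J[t := i]) (\<beta> - {#i#}) * mderiv \<beta> b 0)"
      by (rule sum.reindex_bij_witness[where i = "\<lambda>(\<beta>, i). (i, \<beta> - {#i#})" and j = "\<lambda>(i, M). (add_mset i M, i)"])
        (auto simp: size_Diff_singleton)
    also have "\<dots> = (\<Sum>\<beta> | size \<beta> = Suc r. \<Sum>i\<in>set_mset \<beta>. C (J[t := i]) (\<beta> - {#i#}) * mderiv \<beta> b 0)"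
      by (rule sum.Sigma[symmetric]) (simp_all add: fin)
    also have "\<dots> = 0"
      using J t by (simp add: sum.neutral C_cocycle flip: sum_distrib_right)
    finally show ?thesis .
  qed
  \<comment> \<open>Any value will do: it only fills slot \<open>t\<close> in the representatives of
    the fibres.\<close>
  define k :: 'k where "k = undefined"
  have "coeff_form (fs[t := b]) g
      = (\<Sum>I | length I = s. \<Sum>M | size M \<le> r. C I M * (g 0 * ?E I 0 * mderiv (add_mset (I ! t) M) b 0))"
    unfolding coeff_form_update[OF fs t] by (intro sum.cong refl) (simp add: mderiv_term)
  also have "\<dots> = (\<Sum>J | length J = s \<and> J ! t = k. \<Sum>i\<in>UNIV. \<Sum>M | size M \<le> r.
      C (J[t := i]) M * (g 0 * ?E (J[t := i]) 0 * mderiv (add_mset (J[t := i] ! t) M) b 0))"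
    by (rule list_update_fibres[OF t])
  also have "\<dots> = (\<Sum>J | length J = s \<and> J ! t = k. g 0 * ?E J 0 *
      (\<Sum>i\<in>UNIV. \<Sum>M | size M \<le> r. C (J[t := i]) M * mderiv (add_mset i M) b 0))"
    using t by (intro sum.cong refl) (simp add: deriv_prod_except_update sum_distrib_left ac_simps)
  also have "\<dots> = 0"
    by (intro sum.neutral ballI) (simp add: inner)
  finally show ?thesis .
qed

lemma coeff_form_slot_add:
  assumes fs: "fs \<in> smooth_lists s" and t: "t < s" and "smooth b" "smooth c" "smooth g"
  shows "coeff_form (fs[t := \<lambda>u. b u + c u]) g = coeff_form (fs[t := b]) g + coeff_form (fs[t := c]) g"
proof -
  have "mderiv M (\<lambda>u. g u * (partial_deriv (I ! t) (\<lambda>u. b u + c u) u * deriv_prod_except t I fs u)) 0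
      = mderiv M (\<lambda>u. g u * (partial_deriv (I ! t) b u * deriv_prod_except t I fs u)) 0
      + mderiv M (\<lambda>u. g u * (partial_deriv (I ! t) c u * deriv_prod_except t I fs u)) 0"
    if "length I = s" for I M
  proof -
    have "(\<lambda>u. g u * (partial_deriv (I ! t) (\<lambda>u. b u + c u) u * deriv_prod_except t I fs u))
      = (\<lambda>u. g u * (partial_deriv (I ! t) b u * deriv_prod_except t I fs u)
        + g u * (partial_deriv (I ! t) c u * deriv_prod_except t I fs u))"
      using assms by (simp add: partial_deriv_add smooth_differentiable algebra_simps)
    moreover have "smooth (\<lambda>u. g u * (partial_deriv (I ! t) h u * deriv_prod_except t I fs u))" if "smooth h" for h
      by (intro smooth_mult \<open>smooth g\<close> smooth_partial_deriv that smooth_deriv_prod_except[OF fs \<open>length I = s\<close>])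
    ultimately show ?thesis
      using assms by (simp add: mderiv_add)
  qed
  then show ?thesis
    unfolding coeff_form_update[OF fs t] by (simp add: algebra_simps sum.distrib)
qed

lemma coeff_form_slot_cmult:
  assumes fs: "fs \<in> smooth_lists s" and t: "t < s" and "smooth b" "smooth g"
  shows "coeff_form (fs[t := \<lambda>u. k * b u]) g = k * coeff_form (fs[t := b]) g"
proof -
  have "mderiv M (\<lambda>u. g u * (partial_deriv (I ! t) (\<lambda>u. k * b u) u * deriv_prod_except t I fs u)) 0
      = k * mderiv M (\<lambda>u. g u * (partial_deriv (I ! t) b u * deriv_prod_except t I fs u)) 0"
    if "length I = s" for I M
  proof -
    have "(\<lambda>u. g u * (partial_deriv (I ! t) (\<lambda>u. k * b u) u * deriv_prod_except t I fs u))
      = (\<lambda>u. k * (g u * (partial_deriv (I ! t) b u * deriv_prod_except t I fs u)))"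
      using assms by (simp add: partial_deriv_mult smooth_differentiable algebra_simps)
    moreover have "smooth (\<lambda>u. g u * (partial_deriv (I ! t) b u * deriv_prod_except t I fs u))"
      by (intro smooth_mult \<open>smooth g\<close> smooth_partial_deriv \<open>smooth b\<close> smooth_deriv_prod_except[OF fs that])
    ultimately show ?thesis
      by (simp add: mderiv_cmult)
  qed
  then show ?thesis
    unfolding coeff_form_update[OF fs t] by (simp add: algebra_simps sum_distrib_left)
qed

lemma coeff_form_value_add:
  assumes fs: "fs \<in> smooth_lists s" and "smooth g" "smooth h"
  shows "coeff_form fs (\<lambda>u. g u + h u) = coeff_form fs g + coeff_form fs h"
proof -
  have "mderiv M (\<lambda>u. (g u + h u) * deriv_prod I fs u) 0
      = mderiv M (\<lambda>u. g u * deriv_prod I fs u) 0 + mderiv M (\<lambda>u. h u * deriv_prod I fs u) 0"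
    if "length I = s" for I M
    using mderiv_add[OF smooth_mult[OF assms(2) smooth_deriv_prod[OF fs that]] smooth_mult[OF assms(3) smooth_deriv_prod[OF fs that]]]
    by (simp add: distrib_right)
  then show ?thesis
    unfolding coeff_form_def by (simp add: algebra_simps sum.distrib)
qed

lemma coeff_form_value_cmult:
  assumes fs: "fs \<in> smooth_lists s" and "smooth g"
  shows "coeff_form fs (\<lambda>u. k * g u) = k * coeff_form fs g"
proof -
  have "mderiv M (\<lambda>u. k * g u * deriv_prod I fs u) 0 = k * mderiv M (\<lambda>u. g u * deriv_prod I fs u) 0"
    if "length I = s" for I M
    using mderiv_cmult[OF smooth_mult[OF assms(2) smooth_deriv_prod[OF fs that]]]
    by (simp add: mult.assoc)
  then show ?thesis
    unfolding coeff_form_def by (simp add: algebra_simps sum_distrib_left)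
qed

lemma coeff_form_value_cong:
  assumes fs: "fs \<in> smooth_lists s" and gh: "(g, h) \<in> jet_rel r"
  shows "coeff_form fs g = coeff_form fs h"
  unfolding coeff_form_def
proof (intro sum.cong refl arg_cong2[where f = "(*)"])
  fix I M assume "I \<in> {I :: 'k list. length I = s}" and M: "M \<in> {M :: 'k multiset. size M \<le> r}"
  then have "(\<lambda>u. g u * deriv_prod I fs u, \<lambda>u. h u * deriv_prod I fs u) \<in> jet_rel r"
    by (intro jet_rel_mult gh jet_rel_refl smooth_deriv_prod[OF fs]) simp
  then show "mderiv M (\<lambda>u. g u * deriv_prod I fs u) 0 = mderiv M (\<lambda>u. h u * deriv_prod I fs u) 0"
    using M by (simp add: mem_jet_rel_iff)
qed

lemma coeff_form_skew:
  assumes fs: "fs \<in> smooth_lists s" and ij: "i < s" "j < s" "i \<noteq> j"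
  shows "coeff_form (fs[i := fs ! j, j := fs ! i]) g = - coeff_form fs g"
proof -
  let ?sw = "\<lambda>I :: 'k list. I[i := I ! j, j := I ! i]"
  have "coeff_form (fs[i := fs ! j, j := fs ! i]) g = (\<Sum>I | length I = s. \<Sum>M | size M \<le> r.
      C I M * mderiv M (\<lambda>u. g u * deriv_prod (?sw I) fs u) 0)"
    unfolding coeff_form_def
    using fs ij by (intro sum.cong refl) (simp add: deriv_prod_swap smooth_lists_length)
  also have "\<dots> = (\<Sum>I | length I = s. \<Sum>M | size M \<le> r.
      C (?sw I) M * mderiv M (\<lambda>u. g u * deriv_prod I fs u) 0)"
  proof (rule sum.reindex_bij_witness[where i = ?sw and j = ?sw])
    have "?sw (?sw I) = I" if "length I = s" for I
      using ij that by (intro nth_equalityI) (auto simp: nth_list_update)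
    then show "\<And>I. I \<in> {I. length I = s} \<Longrightarrow> ?sw (?sw I) = I" "\<And>I. I \<in> {I. length I = s} \<Longrightarrow> ?sw (?sw I) = I"
      and "\<And>I. I \<in> {I. length I = s} \<Longrightarrow> (\<Sum>M | size M \<le> r. C (?sw (?sw I)) M * mderiv M (\<lambda>u. g u * deriv_prod (?sw I) fs u) 0)
        = (\<Sum>M | size M \<le> r. C I M * mderiv M (\<lambda>u. g u * deriv_prod (?sw I) fs u) 0)"
      by (simp_all only: mem_Collect_eq)
  qed simp_all
  also have "\<dots> = - coeff_form fs g"
    unfolding coeff_form_def using ij by (simp add: C_skew sum_negf)
  finally show ?thesis .
qed

lemma coeff_form_leibniz:
  assumes fs: "fs \<in> smooth_lists s" and t: "t < s" and "smooth b" "smooth c" "smooth g"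
  shows "coeff_form (fs[t := \<lambda>u. b u * c u]) g
    = coeff_form (fs[t := b]) (\<lambda>u. c u * g u) + coeff_form (fs[t := c]) (\<lambda>u. b u * g u)"
proof -
  have "mderiv M (\<lambda>u. g u * (partial_deriv (I ! t) (\<lambda>u. b u * c u) u * deriv_prod_except t I fs u)) 0
      = mderiv M (\<lambda>u. c u * g u * (partial_deriv (I ! t) b u * deriv_prod_except t I fs u)) 0
      + mderiv M (\<lambda>u. b u * g u * (partial_deriv (I ! t) c u * deriv_prod_except t I fs u)) 0"
    if "length I = s" for I M
  proof -
    have "(\<lambda>u. g u * (partial_deriv (I ! t) (\<lambda>u. b u * c u) u * deriv_prod_except t I fs u))
      = (\<lambda>u. c u * g u * (partial_deriv (I ! t) b u * deriv_prod_except t I fs u)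
        + b u * g u * (partial_deriv (I ! t) c u * deriv_prod_except t I fs u))"
      using assms by (simp add: partial_deriv_mult smooth_differentiable algebra_simps)
    moreover have "smooth (\<lambda>u. k u * g u * (partial_deriv (I ! t) h u * deriv_prod_except t I fs u))"
      if "smooth h" "smooth k" for h k
      by (intro smooth_mult \<open>smooth g\<close> smooth_partial_deriv that smooth_deriv_prod_except[OF fs \<open>length I = s\<close>])
    ultimately show ?thesis
      using assms by (simp add: mderiv_add)
  qed
  then show ?thesis
    unfolding coeff_form_update[OF fs t] by (simp add: algebra_simps sum.distrib)
qed

lemma jet_form_coeff_form: "jet_form r s coeff_form"
proof
  fix fs :: "(real ^ 'k \<Rightarrow> real) list" and b c g :: "real ^ 'k \<Rightarrow> real" and t
  assume fs: "fs \<in> smooth_lists s" and t: "t < s" and bc: "(b, c) \<in> jet_rel r" and g: "smooth g"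
  have sm: "smooth b" "smooth c" using bc by (auto dest: jet_rel_smooth)
  \<comment> \<open>Arguments with equal jets differ by a null jet, so linearity in the slot reduces
    the claim to \<open>coeff_form_null\<close>.\<close>
  have "coeff_form (fs[t := b]) g - coeff_form (fs[t := c]) g = coeff_form (fs[t := \<lambda>u. b u + - 1 * c u]) g"
    using coeff_form_slot_add[OF fs t sm(1) smooth_cmult[OF sm(2)] g, of "- 1"]
      coeff_form_slot_cmult[OF fs t sm(2) g, of "- 1"] by simp
  also have "\<dots> = 0"
    using fs t g by (rule coeff_form_null) (rule iffD1[OF jet_rel_diff_iff[OF sm] bc])
  finally show "coeff_form (fs[t := b]) g = coeff_form (fs[t := c]) g" by simp
qed (rule coeff_form_slot_add coeff_form_slot_cmult coeff_form_skew coeff_form_leibniz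
    coeff_form_value_add coeff_form_value_cmult coeff_form_value_cong; assumption)+

text \<open>Coordinate functions have constant derivatives, so only \<open>I = L\<close>
  contributes, and the duality of monomials then selects \<open>M\<close>.\<close>

lemma coeff_form_monomial:
  assumes "length L = s" "size M \<le> r"
  shows "coeff_form (map coord L) (monomial M) = C L M * mfact M"
proof -
  have fin: "finite {I :: 'k list. length I = s}"
    using finite_lists_length_eq[of "UNIV :: 'k set" s] by simp
  have "coeff_form (map coord L) (monomial M) = (\<Sum>I | length I = s. if I = L then
      \<Sum>N | size N \<le> r. C L N * mderiv N (monomial M) 0 else 0)"
    unfolding coeff_form_def
    using assms(1) by (intro sum.cong refl) (simp add: deriv_prod_coords mderiv_const)
  also have "\<dots> = (\<Sum>N | size N \<le> r. if N = M then C L M * mfact M else 0)"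
    using fin assms(1) by (simp add: mderiv_monomial_0 if_distrib cong: if_cong)
  also have "\<dots> = C L M * mfact M"
    using assms(2) by (simp add: finite_multisets_size_le)
  finally show ?thesis .
qed

end

section \<open>The dual basis\<close>

context jet_form
begin

text \<open>A derivation is determined on generators: it kills \<open>1\<close>, then monomials by
  the product rule, then all jets by Taylor's formula. The hypothesis ranges over all
  \<open>g\<close> because the product rule changes the value argument.\<close>

lemma slot_generated:
  assumes fs: "fs \<in> smooth_lists s" and t: "t < s"
    and coords: "\<And>i g. smooth g \<Longrightarrow> H (fs[t := coord i]) g = 0"
    and "smooth b" "smooth g"
  shows "H (fs[t := b]) g = 0"
proof -
  \<comment> \<open>The product rule for 1 = 1 1 equates the value with its double.\<close>
  have one: "H (fs[t := \<lambda>u. 1]) h = 0" if "smooth h" for h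
    using leibniz[OF fs t smooth_const[of 1] smooth_const[of 1] that] by simp
  have mono: "H (fs[t := monomial M]) h = 0" if "smooth h" for M h
    using that
  proof (induction M arbitrary: h)
    case (add i M)
    then show ?case
      unfolding monomial_add_mset by (subst leibniz[OF fs t]) (simp_all add: coords smooth_mult)
  qed (simp add: one)
  have sum: "H (fs[t := \<lambda>u. \<Sum>M\<in>S. w M * monomial M u]) g = 0" if "finite S" for S w
    using that
  proof induction
    case empty
    show ?case
      using slot_cmult[OF fs t smooth_const[of 1] assms(5), of 0] by simp
  next
    case (insert M S)
    have "smooth (\<lambda>u. \<Sum>M\<in>S. w M * monomial M u)" "smooth (\<lambda>u. w M * monomial M u)"
      by (intro smooth_sum smooth_cmult smooth_monomial)+
    then show ?case
      using insert assms(5) by (simp add: slot_add[OF fs t] slot_cmult[OF fs t] mono)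
  qed
  then show ?thesis
    by (simp only: slot_cong[OF fs t taylor_jet[OF assms(4)] assms(5)] sum[OF finite_multisets_size_le])
qed

lemma value_generated:
  assumes fs: "fs \<in> smooth_lists s" and mono: "\<And>M. size M \<le> r \<Longrightarrow> H fs (monomial M) = 0" and "smooth g"
  shows "H fs g = 0"
proof -
  have sum: "H fs (\<lambda>u. \<Sum>M\<in>S. w M * monomial M u) = 0" if "finite S" "S \<subseteq> {M. size M \<le> r}" for S w
    using that
  proof induction
    case empty
    show ?case
      using value_cmult[OF fs smooth_const[of 1], of 0] by simp
  next
    case (insert M S)
    have "smooth (\<lambda>u. \<Sum>M\<in>S. w M * monomial M u)" "smooth (\<lambda>u. w M * monomial M u)"
      by (intro smooth_sum smooth_cmult smooth_monomial)+
    then show ?case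
      using insert by (simp add: value_add[OF fs] value_cmult[OF fs] mono)
  qed
  then show ?thesis
    by (simp only: value_cong[OF fs taylor_jet[OF assms(3)]] sum[OF finite_multisets_size_le subset_refl])
qed

lemma eq_0_if_coords:
  assumes "\<And>L M. length L = s \<Longrightarrow> size M \<le> r \<Longrightarrow> H (map coord L) (monomial M) = 0"
    and "fs \<in> smooth_lists s" "smooth g"
  shows "H fs g = 0"
proof -
  \<comment> \<open>Only the first \<open>n\<close> slots may hold arbitrary functions.
    \<open>slot_generated\<close> turns the last of them into a coordinate, at the price of a new
    value argument, hence the generalisation over \<open>g\<close>.\<close>
  have upto: "H fs g = 0" if "n \<le> s" "fs \<in> smooth_lists s" "smooth g" "\<forall>t. n \<le> t \<and> t < s \<longrightarrow> fs ! t \<in> range coord" for n fs g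
    using that
  proof (induction n arbitrary: fs g)
    case 0
    have "\<forall>t. \<exists>i. t < s \<longrightarrow> fs ! t = coord i"
      using 0 by auto
    then obtain l where l: "\<forall>t. t < s \<longrightarrow> fs ! t = coord (l t)"
      by metis
    have "fs = map coord (map l [0..<s])"
      using 0 l by (intro nth_equalityI) (simp_all add: smooth_lists_length)
    then show ?case
      using value_generated[OF 0(2) _ 0(3)] assms(1)[of "map l [0..<s]"] by simp
  next
    case (Suc n)
    have n: "n < s" using Suc.prems by simp
    have "H (fs[n := fs ! n]) g = 0"
    proof (rule slot_generated[OF Suc.prems(2) n])
      fix i and h :: "real ^ 'k \<Rightarrow> real" assume "smooth h"
      then show "H (fs[n := coord i]) h = 0"
        using Suc.prems n
        by (intro Suc.IH) (auto simp: smooth_lists_update nth_list_update smooth_lists_length)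
    qed (use Suc.prems n in \<open>auto intro: smooth_lists_nth\<close>)
    then show ?case by simp
  qed
  show ?thesis using assms by (intro upto[of s]) auto
qed

text \<open>The rule D(x^M) = sum of M_i x^(M - i) D(x^i), with the factors moved into the value
  argument. Applied to a monomial of degree \<open>r + 1\<close> it produces the relations among the
  values.\<close>

lemma leibniz_monomial:
  assumes fs: "fs \<in> smooth_lists s" and t: "t < s" and "smooth g"
  shows "H (fs[t := monomial M]) g
    = (\<Sum>i\<in>UNIV. real (count M i) * H (fs[t := coord i]) (\<lambda>u. monomial (M - {#i#}) u * g u))"
  using assms(3)
proof (induction M arbitrary: g)
  case empty
  then show ?case
    using leibniz[OF fs t smooth_const[of 1] smooth_const[of 1] empty] by simp
next
  case (add j M)
  have "H (fs[t := monomial (add_mset j M)]) g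
      = H (fs[t := coord j]) (\<lambda>u. monomial M u * g u) + H (fs[t := monomial M]) (\<lambda>u. u $ j * g u)"
    unfolding monomial_add_mset using add.prems by (intro leibniz[OF fs t]) simp_all
  also have "H (fs[t := monomial M]) (\<lambda>u. u $ j * g u)
      = (\<Sum>i\<in>UNIV. real (count M i) * H (fs[t := coord i]) (\<lambda>u. monomial (M - {#i#}) u * (u $ j * g u)))"
    using add.prems by (intro add.IH) auto
  also have "\<dots> = (\<Sum>i\<in>UNIV. real (count M i) * H (fs[t := coord i]) (\<lambda>u. monomial (add_mset j M - {#i#}) u * g u))"
  proof (intro sum.cong refl)
    fix i
    show "real (count M i) * H (fs[t := coord i]) (\<lambda>u. monomial (M - {#i#}) u * (u $ j * g u))
        = real (count M i) * H (fs[t := coord i]) (\<lambda>u. monomial (add_mset j M - {#i#}) u * g u)"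
    proof (cases "i \<in># M")
      case True
      then have "add_mset j M - {#i#} = add_mset j (M - {#i#})" by simp
      then show ?thesis by (simp add: monomial_add_mset ac_simps)
    qed (simp add: not_in_iff)
  qed
  also have "H (fs[t := coord j]) (\<lambda>u. monomial M u * g u)
      = (\<Sum>i\<in>UNIV. if i = j then H (fs[t := coord i]) (\<lambda>u. monomial (add_mset j M - {#i#}) u * g u) else 0)"
    by simp
  finally show ?case
    unfolding sum.distrib[symmetric] by (auto intro!: sum.cong simp: algebra_simps)
qed

text \<open>Swapping two equal entries changes nothing, yet reverses the sign.\<close>

lemma repeated_coord:
  assumes "length L = s" "\<not> distinct L" "smooth g"
  shows "H (map coord L) g = 0"
proof -
  obtain i j where ij: "i < s" "j < s" "i \<noteq> j" "L ! i = L ! j"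
    using assms(1,2) by (auto simp: distinct_conv_nth)
  let ?fs = "map coord L"
  have "?fs[i := ?fs ! j, j := ?fs ! i] = ?fs"
    using ij assms(1) by (metis list_update_id length_map nth_map)
  then show ?thesis
    using skew[OF coords_smooth_lists[OF assms(1)] ij(1-3) assms(3)] by simp
qed

lemma permuted_coords:
  assumes "mset L = mset L'" "length L' = s" "smooth g" "H (map coord L') g = 0"
  shows "H (map coord L) g = 0"
  using assms(1)
proof (rule swap_invariant_mset[where P = "\<lambda>L. H (map coord L) g = 0"])
  fix L i j assume L: "H (map coord L) g = 0" "mset L = mset L'" and "i < length L" "j < length L" "i \<noteq> j"
  moreover have len: "length L = s"
    using L(2) assms(2) by (metis size_mset)
  ultimately show "H (map coord (L[i := L ! j, j := L ! i])) g = 0"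
    using skew[OF coords_smooth_lists[OF len], of i j g] assms(3) by (simp add: map_update)
qed (rule assms(4))

end

text \<open>An arbitrary enumeration; by skew-symmetry another one would change the values only by a
  sign.\<close>

definition list_of :: "'a set \<Rightarrow> 'a list"
  where "list_of I = (SOME L. set L = I \<and> distinct L)"

lemma list_of:
  fixes I :: "'a::finite set"
  shows "set (list_of I) = I" "distinct (list_of I)" "length (list_of I) = card I"
proof -
  have "set (list_of I) = I \<and> distinct (list_of I)"
    unfolding list_of_def by (rule someI_ex) (use finite_distinct_list[of I] in auto)
  then show "set (list_of I) = I" "distinct (list_of I)" "length (list_of I) = card I"
    using distinct_card[of "list_of I"] by auto
qed

lemma list_of_mset_inject:
  fixes I J :: "'a::finite set"
  shows "mset (list_of I) = mset (list_of J) \<Longrightarrow> I = J"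
  by (metis list_of(1) set_mset_mset)

text \<open>For \<open>size M = r\<close> the value at a pair \<open>(I, M)\<close> that is left out is determined by the relation
  for \<open>\<beta> = M + {max I}\<close>.\<close>

definition basis_indices :: "('k::finite \<Rightarrow> nat) \<Rightarrow> nat \<Rightarrow> nat \<Rightarrow> ('k set \<times> 'k multiset) set"
  where "basis_indices f r s = {(I, M). card I = s \<and> (size M < r \<or> size M = r \<and> (\<exists>j\<in>#M. \<forall>i\<in>I. f i < f j))}"

lemma (in jet_form) eq_0_if_basis_indices:
  assumes f: "inj f"
    and van: "\<And>I M. (I, M) \<in> basis_indices f r s \<Longrightarrow> H (map coord (list_of I)) (monomial M) = 0"
    and "s \<ge> 1" and "fs \<in> smooth_lists s" "smooth g"
  shows "H fs g = 0"
  using _ assms(4,5)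
proof (rule eq_0_if_coords)
  have free: "H (map coord L) (monomial M) = 0"
    if "length L = s" "distinct L" "(set L, M) \<in> basis_indices f r s" for L M
  proof (rule permuted_coords[where L' = "list_of (set L)"])
    show "mset L = mset (list_of (set L))"
      using that by (simp add: list_of flip: set_eq_iff_mset_eq_distinct)
    show "length (list_of (set L)) = s"
      using that by (simp add: list_of distinct_card)
  qed (use that van in simp_all)
  fix L :: "'k list" and M :: "'k multiset" assume L: "length L = s" and M: "size M \<le> r"
  show "H (map coord L) (monomial M) = 0"
  proof (cases "distinct L \<and> (set L, M) \<notin> basis_indices f r s")
    case False
    then show ?thesis using repeated_coord[OF L] free[OF L] by (cases "distinct L") auto
  next
    case True
    then have L': "distinct L" "card (set L) = s" using L distinct_card[of L] by auto
    with True M have size: "size M = r" and bd: "\<forall>j\<in>#M. \<exists>i\<in>set L. f j \<le> f i"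
      by (auto simp: basis_indices_def not_less)
    define x where "x = Max (f ` set L)"
    \<comment> \<open>A largest index exists because \<open>s \<ge> 1\<close>.\<close>
    have "set L \<noteq> {}" using L \<open>s \<ge> 1\<close> by auto
    then have "x \<in> f ` set L" unfolding x_def by (intro Max_in) auto
    then obtain t where t: "t < s" "f (L ! t) = x" using L by (auto simp: in_set_conv_nth)
    define m where "m = L ! t"
    have fm: "f i \<le> f m" if "i \<in> set L" for i
      using that t by (simp add: m_def x_def)
    have fM: "f i \<le> f m" if "i \<in># M" for i
      using that bd fm by (meson order_trans)
    let ?\<beta> = "add_mset m M"
    have fs: "map coord L \<in> smooth_lists s" by (rule coords_smooth_lists[OF L])
    \<comment> \<open>For \<open>i \<noteq> m\<close> the term moves \<open>m\<close> from the list
      to the multi-index and puts the smaller \<open>i\<close> in its slot. As \<open>L\<close> is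
      distinct, all entries are then below \<open>m\<close>, so the pair belongs to
      \<open>basis_indices\<close>, unless \<open>i\<close> repeats an entry and the value is
      \<open>0\<close> anyway.\<close>
    have other: "H ((map coord L)[t := coord i]) (monomial (?\<beta> - {#i#})) = 0" if "i \<in># ?\<beta>" "i \<noteq> m" for i
    proof -
      let ?L = "L[t := i]"
      have i: "f i < f m"
        using that fM[of i] f by (auto simp: inj_def intro: le_neq_implies_less)
      have "f l < f m" if l: "l \<in> set ?L" for l
      proof -
        obtain p where p: "p < s" "l = ?L ! p" using l L by (auto simp: in_set_conv_nth)
        show ?thesis
        proof (cases "p = t")
          case True
          then show ?thesis using p i L by simp
        next
          case False
          then have "L ! p \<noteq> m" using L'(1) p t L by (simp add: m_def nth_eq_iff_index_eq)
          then have "f (L ! p) \<noteq> f m" using f by (auto simp: inj_def)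
          moreover have "f (L ! p) \<le> f m" using fm p L by auto
          ultimately show ?thesis using False p by simp
        qed
      qed
      moreover have "m \<in># ?\<beta> - {#i#}" using that by simp
      moreover have "size (?\<beta> - {#i#}) = r" using that size by (simp add: size_Suc_Diff1)
      ultimately have "distinct ?L \<Longrightarrow> (set ?L, ?\<beta> - {#i#}) \<in> basis_indices f r s"
        using L by (auto simp: basis_indices_def distinct_card)
      then have "H (map coord ?L) (monomial (?\<beta> - {#i#})) = 0"
        using free[of ?L] repeated_coord[of ?L] L by (cases "distinct ?L") auto
      then show ?thesis by (simp add: map_update)
    qed
    \<comment> \<open>A monomial of degree \<open>r + 1\<close> has zero \<open>r\<close>-jet;
      placed in slot \<open>t\<close> it gives the relation in which the wanted value
      occurs.\<close>
    have "(monomial ?\<beta>, \<lambda>u. 0) \<in> jet_rel r"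
      using size by (auto simp: mem_jet_rel_iff mderiv_monomial_0 mderiv_const)
    then have "H ((map coord L)[t := monomial ?\<beta>]) (\<lambda>u. 1) = H ((map coord L)[t := \<lambda>u. 0]) (\<lambda>u. 1)"
      by (intro slot_cong fs t) simp_all
    also have "\<dots> = 0"
      using slot_cmult[OF fs t(1) smooth_const[of 1] smooth_const[of 1], of 0] by simp
    finally have "0 = (\<Sum>i\<in>UNIV. real (count ?\<beta> i) * H ((map coord L)[t := coord i]) (\<lambda>u. monomial (?\<beta> - {#i#}) u * 1))"
      by (subst (asm) leibniz_monomial[OF fs t(1)]) simp_all
    also have "\<dots> = (\<Sum>i\<in>UNIV. if i = m then real (count ?\<beta> m) * H ((map coord L)[t := coord m]) (monomial M) else 0)"
    proof (intro sum.cong refl)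
      fix i
      show "real (count ?\<beta> i) * H ((map coord L)[t := coord i]) (\<lambda>u. monomial (?\<beta> - {#i#}) u * 1)
          = (if i = m then real (count ?\<beta> m) * H ((map coord L)[t := coord m]) (monomial M) else 0)"
        using other[of i] by (cases "i \<in># ?\<beta>") (auto simp: not_in_iff)
    qed
    also have "\<dots> = real (count ?\<beta> m) * H (map coord L) (monomial M)"
    proof -
      have "(map coord L)[t := coord m] = map coord L"
        using t L by (simp add: m_def list_update_same_conv)
      then show ?thesis by simp
    qed
    \<comment> \<open>\<open>count ?\<beta> m\<close> is positive, so the value itself is
      \<open>0\<close>.\<close>
    finally show ?thesis by simp
  qed
qed

lemma card_basis_indices:
  fixes f :: "'k::finite \<Rightarrow> nat"
  assumes "inj f" "r \<ge> 1"
  shows "finite (basis_indices f r s)"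
    and "card (basis_indices f r s) = ((r + s - 1) choose s) * ((r + CARD('k)) choose (r + s))"
proof -
  obtain q where r: "r = Suc q" using assms(2) by (cases r) auto
  let ?I = "{I :: 'k set. card I = s}" and ?N = "{M :: 'k multiset. size M \<le> q}"
  have eq: "basis_indices f r s = ?I \<times> ?N \<union> hook_pairs f r s UNIV"
    by (auto simp: basis_indices_def hook_pairs_def r)
  show fin: "finite (basis_indices f r s)"
    unfolding eq by (simp add: finite_hook_pairs finite_multisets_size_le)
  have "card (basis_indices f r s) = card (?I \<times> ?N) + card (hook_pairs f r s (UNIV :: 'k set))"
    unfolding eq
  proof (rule card_Un_disjoint)
    show "?I \<times> ?N \<inter> hook_pairs f r s UNIV = {}"
      by (auto simp: hook_pairs_def r)
  qed (simp_all add: finite_hook_pairs finite_multisets_size_le)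
  also have "card (?I \<times> ?N) = (CARD('k) choose s) * ((CARD('k) + q) choose q)"
    using n_subsets[of "UNIV :: 'k set" s] by (simp add: card_cartesian_product card_multisets_size_le)
  \<comment> \<open>Now both kinds of pairs have the same first factor, and Pascal's rule combines
    the second factors.\<close>
  also have "\<dots> = ((q + s) choose s) * ((q + CARD('k)) choose (q + s))"
    by (rule trinomial_revision[symmetric])
  also have "card (hook_pairs f r s (UNIV :: 'k set)) = ((q + s) choose s) * ((q + CARD('k)) choose (Suc q + s))"
    unfolding r using assms(1) by (intro card_hook_pairs) auto
  finally show "card (basis_indices f r s) = ((r + s - 1) choose s) * ((r + CARD('k)) choose (r + s))"
    by (simp add: r algebra_simps)
qed

section \<open>Coefficient families dual to the chosen pairs\<close>

lemma coeff_family_low_order: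
  assumes "length L = s" "size M0 < r"
  shows "coeff_family r s (\<lambda>I M. if M = M0 then wedge_coeff L I else 0)"
proof
  fix J :: "'a list" and t and \<beta> :: "'a multiset" assume "size \<beta> = Suc r"
  \<comment> \<open>The cocycle condition involves only multi-indices of size exactly
    \<open>r\<close>, so coefficients below that order are free.\<close>
  then have "\<beta> - {#i#} \<noteq> M0" if "i \<in># \<beta>" for i
    using that assms(2) by (auto simp: size_Diff_singleton)
  then show "(\<Sum>i\<in>set_mset \<beta>. if \<beta> - {#i#} = M0 then wedge_coeff L (J[t := i]) else 0) = 0"
    by (intro sum.neutral) auto
qed (use assms in \<open>simp add: wedge_coeff_swap\<close>)

text \<open>The contraction of \<open>x\<^sup>N dx\<^sup>L\<close> with the Euler vector field; contracting twice gives \<open>0\<close>,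
  which is the cocycle condition.\<close>

lemma coeff_family_contraction:
  fixes L :: "'k::finite list"
  assumes L: "length L = Suc s"
  shows "coeff_family r s (\<lambda>I M. \<Sum>l\<in>set_mset M. if M - {#l#} = N then wedge_coeff L (l # I) else 0)"
proof
  fix I :: "'k list" and i j M assume "length I = s" "i < s" "j < s" "i \<noteq> j"
  \<comment> \<open>Prepending the contracted index \<open>l\<close> shifts the slots by
    one.\<close>
  then have "wedge_coeff L (l # I[i := I ! j, j := I ! i]) = - wedge_coeff L (l # I)" for l
    using wedge_coeff_swap[of "l # I" L "Suc i" "Suc j"] L by simp
  then show "(\<Sum>l\<in>set_mset M. if M - {#l#} = N then wedge_coeff L (l # I[i := I ! j, j := I ! i]) else 0)
      = - (\<Sum>l\<in>set_mset M. if M - {#l#} = N then wedge_coeff L (l # I) else 0)"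
    unfolding sum_negf[symmetric] by (intro sum.cong) auto
next
  fix J :: "'k list" and t and \<beta> :: "'k multiset" assume J: "length J = s" "t < s"
  \<comment> \<open>The double contraction, extended by \<open>0\<close> to all pairs. The condition
    on \<open>{#i, l#}\<close> respects multiplicities and is symmetric, while exchanging positions
    \<open>0\<close> and \<open>Suc t\<close> reverses the sign of the wedge coefficient; so the
    double sum equals its negative.\<close>
  define a where "a i l = (if {#i, l#} \<subseteq># \<beta> \<and> \<beta> - {#i, l#} = N then wedge_coeff L (l # J[t := i]) else 0)" for i l
  have swap: "wedge_coeff L (i # J[t := l]) = - wedge_coeff L (l # J[t := i])" for i l
    using wedge_coeff_swap[of "l # J[t := i]" L 0 "Suc t"] L J by simp
  have anti: "a l i = - a i l" for i l
    using swap[of i l] by (simp add: a_def add_mset_commute)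
  have a_eq: "a i l = (if i \<in># \<beta> \<and> l \<in># \<beta> - {#i#} \<and> \<beta> - {#i#} - {#l#} = N
      then wedge_coeff L (l # J[t := i]) else 0)" for i l
    by (simp add: a_def insert_subset_eq_iff add_mset_commute)
  have "(\<Sum>l\<in>set_mset (\<beta> - {#i#}). if \<beta> - {#i#} - {#l#} = N then wedge_coeff L (l # J[t := i]) else 0)
      = (\<Sum>l\<in>UNIV. a i l)" if "i \<in># \<beta>" for i
    using that
    by (intro sum.mono_neutral_cong_left) (simp_all add: a_eq)
  then have "(\<Sum>i\<in>set_mset \<beta>. \<Sum>l\<in>set_mset (\<beta> - {#i#}). if \<beta> - {#i#} - {#l#} = N then wedge_coeff L (l # J[t := i]) else 0)
      = (\<Sum>i\<in>set_mset \<beta>. \<Sum>l\<in>UNIV. a i l)"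
    by simp
  also have "\<dots> = (\<Sum>i\<in>UNIV. \<Sum>l\<in>UNIV. a i l)"
    by (intro sum.mono_neutral_left) (simp_all add: a_eq)
  finally have eq: "(\<Sum>i\<in>set_mset \<beta>. \<Sum>l\<in>set_mset (\<beta> - {#i#}). if \<beta> - {#i#} - {#l#} = N then wedge_coeff L (l # J[t := i]) else 0)
      = (\<Sum>i\<in>UNIV. \<Sum>l\<in>UNIV. a i l)" .
  have "(\<Sum>i\<in>UNIV. \<Sum>l\<in>UNIV. a i l) = (\<Sum>i\<in>UNIV. \<Sum>l\<in>UNIV. a l i)"
    by (rule sum.swap)
  also have "\<dots> = - (\<Sum>i\<in>UNIV. \<Sum>l\<in>UNIV. a i l)"
    unfolding sum_negf[symmetric] by (intro sum.cong refl) (rule anti)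
  finally have "(\<Sum>i\<in>UNIV. \<Sum>l\<in>UNIV. a i l) = 0" by simp
  with eq show "(\<Sum>i\<in>set_mset \<beta>. \<Sum>l\<in>set_mset (\<beta> - {#i#}). if \<beta> - {#i#} - {#l#} = N then wedge_coeff L (l # J[t := i]) else 0) = 0"
    by simp
qed

text \<open>In top order the witness contracts x^N dx^j dx^I0, where \<open>j\<close> is the largest
  index of \<open>M0\<close> and \<open>M0 = N + j\<close>. Contracting \<open>j\<close> gives the
  pair \<open>(I0, M0)\<close>; since \<open>j\<close> exceeds all of \<open>I0\<close>, the wedge
  factor has no repetition.\<close>

lemma dual_coeff_family:
  fixes f :: "'k::finite \<Rightarrow> nat"
  assumes f: "inj f" and q: "(I0, M0) \<in> basis_indices f r s"
  obtains C where "coeff_family r s C"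
    and "\<And>I M. (I, M) \<in> basis_indices f r s \<Longrightarrow> C (list_of I) M = (if (I, M) = (I0, M0) then 1 else 0)"
proof (cases "size M0 < r")
  case True
  let ?C = "\<lambda>I M. if M = M0 then wedge_coeff (list_of I0) I else 0"
  \<comment> \<open>Only the fixed enumeration of each set is compared, so no sign appears.\<close>
  have "wedge_coeff (list_of I0) (list_of I) = (if I = I0 then 1 else 0)" if "card I = card I0" for I
    using that wedge_coeff_self[OF list_of(2)] wedge_coeff_support[of "list_of I0" "list_of I"]
      list_of_mset_inject[of I I0]
    by (cases "wedge_coeff (list_of I0) (list_of I) = 0") (auto simp: list_of)
  then show ?thesis
    using q True by (intro that[of ?C] coeff_family_low_order) (auto simp: basis_indices_def list_of)
next
  case False
  then have I0: "card I0 = s" and M0: "size M0 = r" and ex: "\<exists>j\<in>#M0. \<forall>i\<in>I0. f i < f j"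
    using q by (auto simp: basis_indices_def)
  have "M0 \<noteq> {#}" using ex by auto
  then have "Max (f ` set_mset M0) \<in> f ` set_mset M0" by (intro Max_in) auto
  then obtain j where j: "j \<in># M0" "f j = Max (f ` set_mset M0)" by auto
  have max: "f m \<le> f j" if "m \<in># M0" for m
    using that j by simp
  have less: "f i < f j" if "i \<in> I0" for i
    using ex max that by (meson less_le_trans)
  then have jI0: "j \<notin> I0" by auto
  obtain N where N: "M0 = add_mset j N" using j by (metis insert_DiffM)
  let ?L = "j # list_of I0"
  let ?C = "\<lambda>I M. \<Sum>l\<in>set_mset M. if M - {#l#} = N then wedge_coeff ?L (l # I) else 0"
  have eq: "l = j \<and> I = I0 \<and> M = M0"
    if IM: "(I, M) \<in> basis_indices f r s" and l: "l \<in># M" "M - {#l#} = N" and w: "wedge_coeff ?L (l # list_of I) \<noteq> 0"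
    for I M l
  proof -
    have M: "M = add_mset l N" using l by (metis insert_DiffM)
    have I: "card I = s" using IM by (simp add: basis_indices_def)
    have ms: "add_mset l (mset (list_of I)) = add_mset j (mset (list_of I0))"
      using wedge_coeff_support[OF w] I I0 by (simp add: list_of)
    have "l = j"
    proof (rule ccontr)
      \<comment> \<open>If another index \<open>l\<close> is contracted, then \<open>l\<close> lies
        in \<open>I0\<close> and \<open>j\<close> in \<open>I\<close>. But \<open>M = N + l\<close>
        has no index above \<open>j\<close>, contrary to the condition on
        \<open>(I, M)\<close>.\<close>
      assume "l \<noteq> j"
      have sets: "insert l I = insert j I0"
        using arg_cong[OF ms, of set_mset] by (simp add: list_of)
      then have "j \<in> I" "l \<in> I0" using \<open>l \<noteq> j\<close> by auto
      have "size M = r" using M M0 N by simp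
      then obtain m where m: "m \<in># M" "\<forall>i\<in>I. f i < f m"
        using IM by (auto simp: basis_indices_def)
      then have "f j < f m" using \<open>j \<in> I\<close> by auto
      moreover have "f m \<le> f j"
        using m(1) M N max less[OF \<open>l \<in> I0\<close>] by auto
      ultimately show False by simp
    qed
    moreover from this ms have "mset (list_of I) = mset (list_of I0)" by simp
    then have "I = I0" by (rule list_of_mset_inject)
    ultimately show ?thesis using M N by simp
  qed
  have "?C (list_of I) M = (if (I, M) = (I0, M0) then 1 else 0)" if IM: "(I, M) \<in> basis_indices f r s" for I M
  proof (cases "(I, M) = (I0, M0)")
    case True
    have "?C (list_of I0) M0 = (\<Sum>l\<in>set_mset M0. if l = j then 1 else 0)"
    proof (intro sum.cong refl)
      fix l assume l: "l \<in># M0"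
      have "wedge_coeff ?L ?L = 1" using jI0 by (intro wedge_coeff_self) (simp add: list_of)
      then show "(if M0 - {#l#} = N then wedge_coeff ?L (l # list_of I0) else 0) = (if l = j then 1 else 0)"
      proof (cases "l = j")
        case False
        then have "\<not> (M0 - {#l#} = N \<and> wedge_coeff ?L (l # list_of I0) \<noteq> 0)"
          using eq[OF q l] by blast
        then show ?thesis using False by auto
      qed (simp add: N)
    qed
    moreover have "I = I0" "M = M0" using True by simp_all
    ultimately show ?thesis using j by (simp only:) simp
  next
    case False
    then have "?C (list_of I) M = 0"
      using eq[OF IM] by (intro sum.neutral) auto
    then show ?thesis using False by simp
  qed
  moreover have "coeff_family r s ?C"
    using I0 by (intro coeff_family_contraction) (simp add: list_of)
  ultimately show ?thesis using that[of ?C] by blast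
qed

text \<open>Subtracting from \<open>x\<close> its expansion with coefficients
  \<open>\<phi> q x\<close> leaves an element of \<open>S\<close> killed by all the functionals,
  hence \<open>0\<close>; duality makes the \<open>e q\<close> independent.\<close>

lemma (in vector_space) dim_dual_basis:
  fixes \<phi> :: "'q \<Rightarrow> 'b \<Rightarrow> 'a"
  assumes S: "subspace S" and Q: "finite Q"
    and add: "\<And>q x y. \<phi> q (x + y) = \<phi> q x + \<phi> q y" and cmult: "\<And>q c x. \<phi> q (scale c x) = c * \<phi> q x"
    and e: "\<And>q. q \<in> Q \<Longrightarrow> e q \<in> S" and dual: "\<And>p q. p \<in> Q \<Longrightarrow> q \<in> Q \<Longrightarrow> \<phi> p (e q) = (if p = q then 1 else 0)"
    and zero: "\<And>x. x \<in> S \<Longrightarrow> (\<And>q. q \<in> Q \<Longrightarrow> \<phi> q x = 0) \<Longrightarrow> x = 0"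
  shows "finite (e ` Q)" "span (e ` Q) = S" "dim S = card Q"
proof -
  have phi0: "\<phi> q 0 = 0" for q using cmult[of q 0 0] by simp
  have phi_sum: "\<phi> p (\<Sum>q\<in>Q. scale (u q) (e q)) = u p" if "p \<in> Q" for p u
  proof -
    have "\<phi> p (\<Sum>q\<in>R. scale (u q) (e q)) = (\<Sum>q\<in>R. u q * \<phi> p (e q))" if "finite R" for R
      using that by induction (simp_all add: phi0 add cmult)
    also have "(\<Sum>q\<in>Q. u q * \<phi> p (e q)) = (\<Sum>q\<in>Q. if q = p then u p else 0)"
      using that by (intro sum.cong) (auto simp: dual)
    finally show ?thesis using Q that by simp
  qed
  show fin: "finite (e ` Q)" using Q by simp
  have inj: "inj_on e Q"
    using dual by (intro inj_onI) (metis zero_neq_one)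
  have "independent (e ` Q)"
  proof
    assume "dependent (e ` Q)"
    then obtain u q where u: "(\<Sum>v\<in>e ` Q. scale (u v) v) = 0" and q: "q \<in> Q" "u (e q) \<noteq> 0"
      using dependent_finite[OF fin] by auto
    have "(\<Sum>p\<in>Q. scale (u (e p)) (e p)) = 0"
      using u by (simp add: sum.reindex[OF inj])
    then show False
      using phi_sum[OF q(1), of "\<lambda>p. u (e p)"] q(2) by (simp add: phi0)
  qed
  moreover have "S \<subseteq> span (e ` Q)"
  proof
    fix x assume x: "x \<in> S"
    let ?y = "\<Sum>q\<in>Q. scale (\<phi> q x) (e q)"
    have yS: "?y \<in> S" using e S by (intro subspace_sum subspace_scale)
    have "x - ?y = 0"
    proof (rule zero)
      show "x - ?y \<in> S" using x yS S by (rule subspace_diff[rotated])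
      fix q assume "q \<in> Q"
      \<comment> \<open>The difference is rewritten through the two operations for which \<phi> is
        assumed linear.\<close>
      have "\<phi> q (x + scale (- 1) ?y) = 0"
        unfolding add cmult using phi_sum[OF \<open>q \<in> Q\<close>, of "\<lambda>q. \<phi> q x"] by simp
      then show "\<phi> q (x - ?y) = 0" by simp
    qed
    moreover have "?y \<in> span (e ` Q)"
      by (intro span_sum span_scale span_base) auto
    ultimately show "x \<in> span (e ` Q)" by simp
  qed
  moreover have "e ` Q \<subseteq> S" using e by auto
  ultimately show "span (e ` Q) = S" "dim S = card Q"
    using span_minimal[OF _ S] dim_unique[of "e ` Q" S "card Q"] card_image[OF inj]
    by (simp_all add: subset_antisym)
qed

text \<open>\<open>dim\<close> is also \<open>0\<close> for spaces without a finite basis, and the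
  formula vanishes for s > k. The finite spanning set in the first conjunct rules out this
  reading.\<close>

theorem mainTheorem2:
  fixes r s :: nat and A :: "(real, 'k::finite jet) module"
  assumes "r \<ge> 1" and "s \<ge> 1"
    and "A = jet_algebra r"
  shows "(\<exists>B. finite B \<and> module.span map_scale B = skew_derivations A s) \<and>
    vector_space.dim map_scale (skew_derivations A s)
      = ((r + s - 1) choose s) * ((r + CARD('k)) choose (r + s))"
proof -
  interpret vector_space "map_scale :: real \<Rightarrow> ('k jet list \<Rightarrow> 'k jet \<Rightarrow> real) \<Rightarrow> _"
    by (rule vector_space_map_scale)
  obtain f :: "'k \<Rightarrow> nat" where f: "inj f"
    using finite_imp_inj_to_nat_seg[of "UNIV :: 'k set"] by auto
  let ?Q = "basis_indices f r s"
  \<comment> \<open>Dividing by \<open>mfact M\<close> recovers the coefficient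
    \<open>C (list_of I) M\<close> from the value computed in
    \<open>coeff_form_monomial\<close>.\<close>
  define \<phi> :: "'k set \<times> 'k multiset \<Rightarrow> ('k jet list \<Rightarrow> 'k jet \<Rightarrow> real) \<Rightarrow> real"
    where "\<phi> = (\<lambda>(I, M) F. F (map (jet_of r) (map coord (list_of I))) (jet_of r (monomial M)) / mfact M)"
  have "\<exists>F\<in>skew_derivations A s. \<forall>p\<in>?Q. \<phi> p F = (if p = q then 1 else 0)" if "q \<in> ?Q" for q
  proof -
    obtain I0 M0 where q: "q = (I0, M0)" by fastforce
    obtain C where C: "coeff_family r s C"
      and val: "\<And>I M. (I, M) \<in> ?Q \<Longrightarrow> C (list_of I) M = (if (I, M) = (I0, M0) then 1 else 0)"
      by (rule dual_coeff_family[OF f \<open>q \<in> ?Q\<close>[unfolded q]]) (rule that, assumption, simp)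
    interpret C: coeff_family r s C by (rule C)
    interpret J: jet_form r s C.coeff_form by (rule C.jet_form_coeff_form)
    have "\<phi> p J.lift = (if p = q then 1 else 0)" if "p \<in> ?Q" for p
    proof -
      obtain I M where p: "p = (I, M)" by fastforce
      then have "length (list_of I) = s" "size M \<le> r"
        using that by (auto simp: basis_indices_def list_of)
      then have "\<phi> p J.lift = C (list_of I) M * mfact M / mfact M"
        unfolding \<phi>_def p prod.case
        by (subst J.lift_jet_of) (simp_all add: coords_smooth_lists C.coeff_form_monomial)
      then show ?thesis
        using val that mfact_pos[of M] p q by simp
    qed
    then show ?thesis
      using J.lift_skew_derivation assms(3) by (intro bexI[where x = J.lift]) simp_all
  qed
  then have "\<forall>q\<in>?Q. \<exists>F. F \<in> skew_derivations A s \<and> (\<forall>p\<in>?Q. \<phi> p F = (if p = q then 1 else 0))"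
    by blast
  from bchoice[OF this] obtain e where e: "\<And>q. q \<in> ?Q \<Longrightarrow> e q \<in> skew_derivations A s"
    and dual: "\<And>p q. p \<in> ?Q \<Longrightarrow> q \<in> ?Q \<Longrightarrow> \<phi> p (e q) = (if p = q then 1 else 0)"
    by auto
  have zero: "F = 0" if F: "F \<in> skew_derivations A s" and van: "\<And>q. q \<in> ?Q \<Longrightarrow> \<phi> q F = 0" for F
  proof (rule skew_derivation_eq_0)
    show F': "F \<in> skew_derivations (jet_algebra r) s" using F assms(3) by simp
    interpret jet_form r s "\<lambda>fs g. F (map (jet_of r) fs) (jet_of r g)"
      by (rule jet_form_of_skew_derivation[OF F'])
    have "F (map (jet_of r) (map coord (list_of I))) (jet_of r (monomial M)) = 0" if "(I, M) \<in> ?Q" for I M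
      using van[OF that] mfact_pos[of M] by (simp add: \<phi>_def)
    then show "F (map (jet_of r) fs) (jet_of r g) = 0" if "fs \<in> smooth_lists s" "smooth g" for fs g
      by (rule eq_0_if_basis_indices[OF f _ assms(2) that])
  qed
  have linear: "\<phi> q (x + y) = \<phi> q x + \<phi> q y" "\<phi> q (map_scale c x) = c * \<phi> q x" for q x y c
    by (simp_all add: \<phi>_def map_scale_def add_divide_distrib split: prod.split)
  note basis = dim_dual_basis[OF subspace_skew_derivations card_basis_indices(1)[OF f assms(1)] linear e dual zero]
  have "\<exists>B. finite B \<and> span B = skew_derivations A s"
    by (intro exI conjI) (rule basis(1), assumption+, rule basis(2))
  moreover have "dim (skew_derivations A s) = ((r + s - 1) choose s) * ((r + CARD('k)) choose (r + s))"
    using basis(3) by (simp only: card_basis_indices(2)[OF f assms(1)])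
  ultimately show ?thesis by simp
qed

end
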